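(* Let $N=2$, $\Omega\subset\mathbb{R}^2$ a bounded domain, $F$ as in the context, and $E(u)=\frac12\int_\Omega F^2(\nabla u)\,dx-\lambda\int_\Omega e^u\,dx$ on $W_0^{1,2}(\Omega)$. There exists a constant $\lambda_0>0$ such that for every $\lambda\in(0,\lambda_0)$ the functional $E$ has a critical point with critical value $c'<-\lambda|\Omega|$.
   Context: Standing assumptions on $F$: $F:\mathbb{R}^N\to[0,\infty)$ is convex, $F\in C^2(\mathbb{R}^N\setminus\{0\})$, $F(t\xi)=|t|F(\xi)$, $F(\xi)>0$ for $\xi\neq0$; $a|\xi|\le F(\xi)\le b|\xi|$ for constants $0<a\le b$; and $\mu^2|V|^2\le\sum_{i,j}F_{\xi_i\xi_j}(\xi)V_iV_j\le\Lambda|V|^2$ for all unit $\xi$ and all $V\perp\xi$. *)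

theory Defs
  imports "HOL-Analysis.Analysis"
begin

definition grad :: "(real^2 \<Rightarrow> real) \<Rightarrow> real^2 \<Rightarrow> real^2" where
  "grad f x = (\<chi> i. frechet_derivative f (at x) (axis i 1))"

coinductive smooth2 :: "(real^2 \<Rightarrow> real) \<Rightarrow> bool" where
  "(\<forall>x. f differentiable (at x)) \<Longrightarrow>
   (\<forall>i. smooth2 (\<lambda>x. frechet_derivative f (at x) (axis i 1))) \<Longrightarrow> smooth2 f"

definition test_fun :: "(real^2) set \<Rightarrow> (real^2 \<Rightarrow> real) \<Rightarrow> bool" where
  "test_fun \<Omega> \<phi> \<longleftrightarrow> smooth2 \<phi> \<and> compact (closure {x. \<phi> x \<noteq> 0})
      \<and> closure {x. \<phi> x \<noteq> 0} \<subseteq> \<Omega>"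

text \<open>u belongs to W_0^{1,2}(Omega) with weak gradient g: (u, g) is the limit in
  L^2(Omega) x L^2(Omega;R^2) of (phi_n, grad phi_n) for test functions phi_n.\<close>
definition W012_0 :: "(real^2) set \<Rightarrow> (real^2 \<Rightarrow> real) \<Rightarrow> (real^2 \<Rightarrow> real^2) \<Rightarrow> bool" where
  "W012_0 \<Omega> u g \<longleftrightarrow>
     set_borel_measurable lebesgue \<Omega> u \<and> set_borel_measurable lebesgue \<Omega> g \<and>
     set_integrable lebesgue \<Omega> (\<lambda>x. (u x)\<^sup>2) \<and>
     set_integrable lebesgue \<Omega> (\<lambda>x. (norm (g x))\<^sup>2) \<and>
     (\<exists>\<phi> :: nat \<Rightarrow> real^2 \<Rightarrow> real. (\<forall>n. test_fun \<Omega> (\<phi> n)) \<and>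
        (\<lambda>n. LINT x:\<Omega>|lebesgue. (\<phi> n x - u x)\<^sup>2) \<longlonglongrightarrow> 0 \<and>
        (\<lambda>n. LINT x:\<Omega>|lebesgue. (norm (grad (\<phi> n) x - g x))\<^sup>2) \<longlonglongrightarrow> 0)"

definition energy :: "(real^2) set \<Rightarrow> (real^2 \<Rightarrow> real) \<Rightarrow> real \<Rightarrow>
    (real^2 \<Rightarrow> real) \<Rightarrow> (real^2 \<Rightarrow> real^2) \<Rightarrow> real" where
  "energy \<Omega> F lam u g = (1/2) * (LINT x:\<Omega>|lebesgue. (F (g x))\<^sup>2)
       - lam * (LINT x:\<Omega>|lebesgue. exp (u x))"

definition critical_point :: "(real^2) set \<Rightarrow> (real^2 \<Rightarrow> real) \<Rightarrow> real \<Rightarrow>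
    (real^2 \<Rightarrow> real) \<Rightarrow> (real^2 \<Rightarrow> real^2) \<Rightarrow> bool" where
  "critical_point \<Omega> F lam u g \<longleftrightarrow> W012_0 \<Omega> u g \<and>
     set_integrable lebesgue \<Omega> (\<lambda>x. exp (u x)) \<and>
     (\<forall>v h. W012_0 \<Omega> v h \<longrightarrow>
        ((\<lambda>t. energy \<Omega> F lam (\<lambda>x. u x + t * v x) (\<lambda>x. g x + t *\<^sub>R h x))
           has_real_derivative 0) (at 0))"

definition admissible_F :: "(real^2 \<Rightarrow> real) \<Rightarrow> bool" where
  "admissible_F F \<longleftrightarrow>
     convex_on UNIV F \<and> (\<forall>\<xi>. F \<xi> \<ge> 0) \<and>
     (\<forall>t \<xi>. F (t *\<^sub>R \<xi>) = \<bar>t\<bar> * F \<xi>) \<and> (\<forall>\<xi>. \<xi> \<noteq> 0 \<longrightarrow> F \<xi> > 0) \<and>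
     (\<exists>a b. 0 < a \<and> a \<le> b \<and> (\<forall>\<xi>. a * norm \<xi> \<le> F \<xi> \<and> F \<xi> \<le> b * norm \<xi>)) \<and>
     (\<exists>(DF :: real^2 \<Rightarrow> real^2) (H :: real^2 \<Rightarrow> real^2^2) \<mu> \<Lambda>.
        (\<forall>\<xi>. \<xi> \<noteq> 0 \<longrightarrow> (F has_derivative (\<lambda>v. DF \<xi> \<bullet> v)) (at \<xi>) \<and>
                          (DF has_derivative (\<lambda>v. H \<xi> *v v)) (at \<xi>)) \<and>
        continuous_on (- {0}) H \<and> 0 < \<mu> \<and>
        (\<forall>\<xi> V. norm \<xi> = 1 \<and> V \<bullet> \<xi> = 0 \<longrightarrow>
            \<mu>\<^sup>2 * (norm V)\<^sup>2 \<le> V \<bullet> (H \<xi> *v V) \<and> V \<bullet> (H \<xi> *v V) \<le> \<Lambda> * (norm V)\<^sup>2))"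

end

theory Submission
  imports Defs
begin

text \<open>
  Let \<open>D(u) = \<integral> |\<nabla>u|\<^sup>2\<close>. Applying the embedding of \<open>W\<^sup>1\<^sup>,\<^sup>1\<close> into \<open>L\<^sup>2\<close> to powers of a test function gives
  \<open>\<integral> u\<^bsup>2k\<^esup> \<le> k!\<^sup>2 D(u)\<^bsup>k\<^esup> |\<Omega>|\<close>; summing the exponential series, \<open>\<integral> exp (s|u|) \<le> 4|\<Omega>|\<close> whenever
  \<open>s\<^sup>2 D(u) \<le> 1/2\<close>. This weak form of the Moser--Trudinger inequality is all that is needed.
  The ellipticity of \<open>F\<close> makes \<open>F\<^sup>2\<close> strongly convex, and on the ball \<open>D(u) \<le> 1/32\<close> the second variation
  of the exponential term is bounded by a multiple of \<open>\<lambda> D\<close>. Hence for small \<open>\<lambda>\<close> the energy \<open>E\<close> is strongly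
  convex on that ball, minimizing sequences of test functions are Cauchy, and a minimizer exists.
  Since \<open>E\<close> decreases from \<open>0\<close> in the direction of a nonnegative bump function, the minimum is below
  \<open>E(0) = -\<lambda>|\<Omega>|\<close>; comparing with \<open>E(0)\<close> shows that for small \<open>\<lambda>\<close> the minimizer lies in the interior of
  the ball, so it is a critical point.
\<close>

section \<open>Strong convexity of the squared Finsler norm\<close>

text \<open>On the whole space \<open>E\<close> is unbounded below, because the exponential term
  beats any quadratic; hence the constraint on \<open>D\<close>, and hence the need to show that the
  minimizer does not feel it. Convexity on the ball takes the place of weak compactness and lower
  semicontinuity: the midpoint of two near-minimizers would undercut the infimum unless their
  gradients were close in L2. Only midpoint convexity is used, which suits an \<open>F\<close> that
  is not differentiable at 0. Competitors are test functions, for which every integral exists and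
  powers can be differentiated; members of \<open>W012_0\<close> are limits of these, so estimates
  reach them by Fatou or by L2 continuity. The radius 1/32 makes \<open>s = 2\<close> admissible in
  the exponential estimate, so that \<open>exp u\<close> is bounded in L2. Two conditions on
  \<lambda> then remain: \<open>lam * vol \<le> \<kappa> / 4\<close> keeps half of the convexity of
  the gradient term, and \<open>lam * vol \<le> a\<^sup>2 / 256\<close> keeps the minimizer off the
  boundary of the ball.\<close>

lemma admissible_F_subadditive:
  assumes "admissible_F F"
  shows "F (x + y) \<le> F x + F y"
proof -
  have "F ((1/2) *\<^sub>R (2 *\<^sub>R x) + (1/2) *\<^sub>R (2 *\<^sub>R y)) \<le> (1/2) * F (2 *\<^sub>R x) + (1/2) * F (2 *\<^sub>R y)"
    using convex_onD[of UNIV F "1/2" "2 *\<^sub>R x" "2 *\<^sub>R y"] assms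
    by (simp add: admissible_F_def)
  moreover have "F (2 *\<^sub>R z) = 2 * F z" for z
    using assms unfolding admissible_F_def by (metis abs_numeral)
  ultimately show ?thesis by simp
qed

lemma admissible_F_even:
  assumes "admissible_F F"
  shows "F (- x) = F x"
proof -
  have "F ((-1) *\<^sub>R x) = \<bar>-1\<bar> * F x"
    using assms unfolding admissible_F_def by blast
  then show ?thesis by simp
qed

lemma admissible_F_abs_diff_le:
  assumes "admissible_F F"
  shows "\<bar>F x - F y\<bar> \<le> F (x - y)"
  using admissible_F_subadditive[OF assms, of "x - y" y]
    admissible_F_subadditive[OF assms, of "y - x" x] admissible_F_even[OF assms, of "x - y"]
  by simp

lemma admissible_F_bounds:
  assumes "admissible_F F"
  obtains a b where "0 < a" "a \<le> b" "\<And>x. a * norm x \<le> F x" "\<And>x. F x \<le> b * norm x"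
  using assms unfolding admissible_F_def by auto

lemma admissible_F_continuous:
  assumes "admissible_F F"
  shows "continuous_on UNIV F"
proof -
  obtain a b where ab: "0 < a" "a \<le> b" "\<And>x. a * norm x \<le> F x" "\<And>x. F x \<le> b * norm x"
    using admissible_F_bounds[OF assms] by metis
  have "b-lipschitz_on UNIV F"
    using ab admissible_F_abs_diff_le[OF assms]
    by (auto intro!: lipschitz_onI simp: dist_norm) (meson order_trans)
  then show ?thesis by (rule lipschitz_on_continuous_on)
qed

text \<open>A difference of squares, combined with the Lipschitz estimate that subadditivity gives.
  This is the form in which the square of \<open>F\<close> enters later: it makes the gradient term
  continuous under L2 convergence and dominates its difference quotients.\<close>

lemma admissible_F_sq_diff_le:
  assumes "admissible_F F" "\<And>x. F x \<le> b * norm x" "0 \<le> b"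
  shows "\<bar>(F x)\<^sup>2 - (F y)\<^sup>2\<bar> \<le> b\<^sup>2 * (norm (x - y) * (norm x + norm y))"
proof -
  have nn: "F z \<ge> 0" for z using assms(1) unfolding admissible_F_def by auto
  have "\<bar>(F x)\<^sup>2 - (F y)\<^sup>2\<bar> = \<bar>F x - F y\<bar> * (F x + F y)"
    using nn[of x] nn[of y] by (simp add: power2_eq_square square_diff_square_factored abs_mult)
  also have "\<dots> \<le> (b * norm (x - y)) * (b * norm x + b * norm y)"
    using admissible_F_abs_diff_le[OF assms(1), of x y] assms(2)[of "x - y"] assms(2)[of x] assms(2)[of y] nn
    by (intro mult_mono) (auto simp: assms(3))
  finally show ?thesis by (simp add: power2_eq_square algebra_simps)
qed

text \<open>Gradient and Hessian, which \<open>admissible_F\<close> only asserts to exist, become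
  parameters. Convexity enters as subadditivity, and derivatives are available only off the
  origin.\<close>

locale finsler_hessian =
  fixes F :: "real^2 \<Rightarrow> real" and DF :: "real^2 \<Rightarrow> real^2" and H :: "real^2 \<Rightarrow> real^2^2"
    and a b \<mu> :: real
  assumes hom: "\<And>t x. F (t *\<^sub>R x) = \<bar>t\<bar> * F x"
    and subadd: "\<And>x y. F (x + y) \<le> F x + F y"
    and a_pos: "0 < a" and lower: "\<And>x. a * norm x \<le> F x" and upper: "\<And>x. F x \<le> b * norm x"
    and \<mu>_pos: "0 < \<mu>"
    and DF: "\<And>x. x \<noteq> 0 \<Longrightarrow> (F has_derivative (\<lambda>v. DF x \<bullet> v)) (at x)"
    and H: "\<And>x. x \<noteq> 0 \<Longrightarrow> (DF has_derivative (\<lambda>v. H x *v v)) (at x)"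
    and ell: "\<And>x V. norm x = 1 \<Longrightarrow> V \<bullet> x = 0 \<Longrightarrow> \<mu>\<^sup>2 * (norm V)\<^sup>2 \<le> V \<bullet> (H x *v V)"
begin

section \<open>Homogeneity identities and ellipticity off the origin\<close>

lemma b_pos: "0 < b"
proof -
  obtain x :: "real^2" where "norm x = 1" using vector_choose_size[of 1] by auto
  then show ?thesis using lower[of x] upper[of x] a_pos by auto
qed

text \<open>Differentiating \<open>F (t *\<^sub>R y) = t * F y\<close> in \<open>y\<close> in two
  ways cancels the factor \<open>t\<close>: the gradient has degree 0.\<close>

lemma DF_homogeneous:
  assumes "x \<noteq> 0" "0 < t"
  shows "DF (t *\<^sub>R x) = DF x"
proof -
  have tx: "t *\<^sub>R x \<noteq> 0" using assms by simp
  have "((\<lambda>y. F (t *\<^sub>R y)) has_derivative (\<lambda>v. DF (t *\<^sub>R x) \<bullet> (t *\<^sub>R v))) (at x)"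
    by (rule has_derivative_compose[where g = F and f = "\<lambda>y. t *\<^sub>R y"])
       (use DF[OF tx] in \<open>auto intro!: derivative_eq_intros\<close>)
  then have 1: "((\<lambda>y. t * F y) has_derivative (\<lambda>v. DF (t *\<^sub>R x) \<bullet> (t *\<^sub>R v))) (at x)"
    using assms by (simp add: hom)
  have 2: "((\<lambda>y. t * F y) has_derivative (\<lambda>v. t * (DF x \<bullet> v))) (at x)"
    by (rule has_derivative_mult_right[OF DF[OF assms(1)]])
  have "(\<lambda>v. DF (t *\<^sub>R x) \<bullet> (t *\<^sub>R v)) = (\<lambda>v. t * (DF x \<bullet> v))"
    by (rule has_derivative_unique[OF 1 2])
  then have "DF (t *\<^sub>R x) \<bullet> v = DF x \<bullet> v" for v
    using assms by (auto dest: fun_cong[where x = v])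
  then show ?thesis using vector_eq_rdot by blast
qed

text \<open>One more differentiation lowers the degree to -1, so the Hessian on the unit sphere
  determines it at every nonzero point.\<close>

lemma H_homogeneous:
  assumes "x \<noteq> 0" "0 < t"
  shows "t *\<^sub>R (H (t *\<^sub>R x) *v v) = H x *v v"
proof -
  have tx: "t *\<^sub>R x \<noteq> 0" using assms by simp
  have "((\<lambda>y. DF (t *\<^sub>R y)) has_derivative (\<lambda>v. H (t *\<^sub>R x) *v (t *\<^sub>R v))) (at x)"
    by (rule has_derivative_compose[where g = DF and f = "\<lambda>y. t *\<^sub>R y"])
       (use H[OF tx] in \<open>auto intro!: derivative_eq_intros\<close>)
  then have 1: "(DF has_derivative (\<lambda>v. H (t *\<^sub>R x) *v (t *\<^sub>R v))) (at x)"
    by (rule has_derivative_transform_within_open[where s = "- {0}"])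
       (use assms in \<open>auto simp: DF_homogeneous\<close>)
  have "(\<lambda>v. H (t *\<^sub>R x) *v (t *\<^sub>R v)) = (\<lambda>v. H x *v v)"
    by (rule has_derivative_unique[OF 1 H[OF assms(1)]])
  then show ?thesis
    by (auto simp: matrix_vector_mult_scaleR dest: fun_cong[where x = v])
qed

lemma euler:
  assumes "x \<noteq> 0"
  shows "DF x \<bullet> x = F x"
proof -
  have "((\<lambda>t::real. F (t *\<^sub>R x)) has_derivative (\<lambda>s. DF x \<bullet> (s *\<^sub>R x))) (at 1)"
    by (rule has_derivative_compose[where g = F and f = "\<lambda>t. t *\<^sub>R x"])
       (use DF[OF assms] in \<open>auto intro!: derivative_eq_intros\<close>)
  then have 1: "((\<lambda>t::real. t * F x) has_derivative (\<lambda>s. DF x \<bullet> (s *\<^sub>R x))) (at 1)"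
    by (rule has_derivative_transform_within_open[where s = "{0<..}"]) (auto simp: hom)
  have 2: "((\<lambda>t::real. t * F x) has_derivative (\<lambda>s. s * F x)) (at 1)"
    by (auto intro!: derivative_eq_intros)
  show ?thesis using fun_cong[OF has_derivative_unique[OF 1 2], of 1] by simp
qed

text \<open>The gradient is constant along rays, so its radial derivative vanishes.\<close>

lemma H_radial:
  assumes "x \<noteq> 0"
  shows "H x *v x = 0"
proof -
  have "((\<lambda>t::real. DF (t *\<^sub>R x)) has_derivative (\<lambda>s. H x *v (s *\<^sub>R x))) (at 1)"
    by (rule has_derivative_compose[where g = DF and f = "\<lambda>t. t *\<^sub>R x"])
       (use H[OF assms] in \<open>auto intro!: derivative_eq_intros\<close>)
  then have 1: "((\<lambda>t::real. DF x) has_derivative (\<lambda>s. H x *v (s *\<^sub>R x))) (at 1)"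
    by (rule has_derivative_transform_within_open[where s = "{0<..}"])
       (use assms in \<open>auto simp: DF_homogeneous\<close>)
  show ?thesis using fun_cong[OF has_derivative_unique[OF 1 has_derivative_const], of 1] by simp
qed

text \<open>Differentiating Euler's identity \<open>DF y \<bullet> y = F y\<close> leaves exactly
  this extra term. Together with \<open>H_radial\<close> it removes all mixed terms of the quadratic
  form without an appeal to the symmetry of \<open>H\<close>.\<close>

lemma radial_H:
  assumes "x \<noteq> 0"
  shows "x \<bullet> (H x *v v) = 0"
proof -
  have "((\<lambda>y. DF y \<bullet> y) has_derivative (\<lambda>v. DF x \<bullet> v + (H x *v v) \<bullet> x)) (at x)"
    using has_derivative_inner[OF H[OF assms] has_derivative_ident] by simp
  then have 1: "(F has_derivative (\<lambda>v. DF x \<bullet> v + (H x *v v) \<bullet> x)) (at x)"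
    by (rule has_derivative_transform_within_open[where s = "- {0}"])
       (use assms in \<open>auto simp: euler\<close>)
  show ?thesis
    using fun_cong[OF has_derivative_unique[OF 1 DF[OF assms]], of v] by (simp add: inner_commute)
qed

text \<open>By subadditivity and homogeneity every right difference quotient of \<open>F\<close> at
  \<open>x\<close> in direction \<open>v\<close> is at most \<open>F v\<close>. Using
  \<open>v\<close> and \<open>- v\<close> bounds the gradient by \<open>b\<close>.\<close>

lemma DF_le:
  assumes "x \<noteq> 0"
  shows "DF x \<bullet> v \<le> F v"
proof -
  have "((\<lambda>t::real. F (x + t *\<^sub>R v)) has_derivative (\<lambda>s. DF x \<bullet> (s *\<^sub>R v))) (at 0)"
    by (rule has_derivative_compose[where g = F and f = "\<lambda>t. x + t *\<^sub>R v"])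
       (use DF[OF assms] in \<open>auto intro!: derivative_eq_intros\<close>)
  then have "((\<lambda>t::real. F (x + t *\<^sub>R v)) has_real_derivative (DF x \<bullet> v)) (at 0)"
    by (simp add: has_field_derivative_def mult_commute_abs)
  then have "((\<lambda>t. (F (x + t *\<^sub>R v) - F x) / t) \<longlongrightarrow> DF x \<bullet> v) (at_right 0)"
    unfolding DERIV_def by (simp add: filterlim_at_split)
  moreover have "\<forall>\<^sub>F t in at_right 0. (F (x + t *\<^sub>R v) - F x) / t \<le> F v"
    unfolding eventually_at_right_field
  proof (intro exI[of _ 1] conjI allI impI)
    fix t :: real assume t: "0 < t"
    show "(F (x + t *\<^sub>R v) - F x) / t \<le> F v"
      using subadd[of x "t *\<^sub>R v"] t hom[of t v] by (simp add: divide_le_eq mult.commute)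
  qed auto
  ultimately show ?thesis
    by (intro tendsto_upperbound) auto
qed

lemma abs_DF_le:
  assumes "x \<noteq> 0"
  shows "\<bar>DF x \<bullet> v\<bar> \<le> b * norm v"
  using DF_le[OF assms, of v] DF_le[OF assms, of "- v"] upper[of v] upper[of "- v"] by auto

text \<open>Ellipticity is given on the unit sphere only; degree -1 carries it to \<open>x\<close>
  at the price of the factor \<open>norm x\<close>.\<close>

lemma H_elliptic:
  assumes x: "x \<noteq> 0" and W: "W \<bullet> x = 0"
  shows "\<mu>\<^sup>2 * (norm W)\<^sup>2 \<le> norm x * (W \<bullet> (H x *v W))"
proof -
  have "H (sgn x) *v W = norm x *\<^sub>R (H x *v W)"
    using H_homogeneous[of x "inverse (norm x)" W] x
    by (simp add: sgn_div_norm) (metis norm_eq_zero right_inverse scaleR_one scaleR_scaleR)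
  moreover have "norm (sgn x) = 1" "W \<bullet> sgn x = 0"
    using x W by (auto simp: norm_sgn sgn_div_norm)
  ultimately show ?thesis using ell[of "sgn x" W] by simp
qed

text \<open>\<open>\<theta>\<close> is the share of the radial square that is used: small enough for
  its tangential error \<open>\<theta> * b\<^sup>2\<close> to cost at most half of the tangential
  coefficient \<open>a * \<mu>\<^sup>2\<close>. The minimum of the two coefficients that survive is
  \<open>convexity_const\<close>.\<close>

definition "\<theta> = min 1 (a * \<mu>\<^sup>2 / (2 * b\<^sup>2))"
definition "convexity_const = min (\<theta> * a\<^sup>2 / 2) (a * \<mu>\<^sup>2 / 2)"

lemma \<theta>: "0 < \<theta>" "\<theta> \<le> 1" "\<theta> * b\<^sup>2 \<le> a * \<mu>\<^sup>2 / 2"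
proof -
  show "0 < \<theta>" "\<theta> \<le> 1" unfolding \<theta>_def using a_pos b_pos \<mu>_pos by auto
  have "\<theta> * b\<^sup>2 \<le> (a * \<mu>\<^sup>2 / (2 * b\<^sup>2)) * b\<^sup>2" unfolding \<theta>_def by (intro mult_right_mono) auto
  then show "\<theta> * b\<^sup>2 \<le> a * \<mu>\<^sup>2 / 2" using b_pos by simp
qed

lemma convexity_const_pos: "0 < convexity_const"
  unfolding convexity_const_def using \<theta> a_pos \<mu>_pos by auto

lemma convexity_const_le: "convexity_const \<le> a\<^sup>2"
proof -
  have "\<theta> * a\<^sup>2 \<le> 1 * a\<^sup>2" by (intro mult_right_mono \<theta>) auto
  then show ?thesis unfolding convexity_const_def using zero_le_power2[of a] by linarith
qed

text \<open>The left-hand side is the Hessian of \<open>F\<^sup>2 / 2\<close>; its first summand controls the radial part of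
  \<open>V\<close> up to an error in the tangential part, which the second summand controls.\<close>
lemma hessian_half_square_ge:
  assumes x: "x \<noteq> 0"
  shows "convexity_const * (norm V)\<^sup>2 \<le> (DF x \<bullet> V)\<^sup>2 + F x * (V \<bullet> (H x *v V))"
proof -
  define e where "e = sgn x"
  have xe: "x = norm x *\<^sub>R e" and e1: "norm e = 1" using x by (auto simp: e_def sgn_div_norm norm_sgn)
  have ee: "e \<bullet> e = 1" using e1 by (simp add: norm_eq_1)
  define \<alpha> where "\<alpha> = V \<bullet> e"
  define W where "W = V - \<alpha> *\<^sub>R e"
  have V: "V = \<alpha> *\<^sub>R e + W" by (simp add: W_def)
  have We: "W \<bullet> e = 0" by (simp add: W_def \<alpha>_def inner_diff_left ee)
  then have Wx: "W \<bullet> x = 0" by (metis xe inner_scaleR_right mult_zero_right)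
  have nV: "(norm V)\<^sup>2 = \<alpha>\<^sup>2 + (norm W)\<^sup>2"
    unfolding V power2_norm_eq_inner by (simp add: inner_simps ee We inner_commute[of e W] power2_eq_square)
  have He: "H x *v e = 0"
    using H_radial[OF x] x unfolding e_def by (simp add: sgn_div_norm matrix_vector_mult_scaleR)
  have eH: "e \<bullet> (H x *v v) = 0" for v
    using radial_H[OF x] x unfolding e_def by (simp add: sgn_div_norm)
  have VH: "V \<bullet> (H x *v V) = W \<bullet> (H x *v W)"
    unfolding V by (simp add: matrix_vector_right_distrib matrix_vector_mult_scaleR He inner_add_left eH)
  have WHW: "\<mu>\<^sup>2 * (norm W)\<^sup>2 \<le> norm x * (W \<bullet> (H x *v W))" by (rule H_elliptic[OF x Wx])
  then have WHW0: "0 \<le> W \<bullet> (H x *v W)"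
    using x by (smt (verit) mult_nonneg_nonneg zero_le_power2 zero_le_mult_iff zero_less_norm_iff)
  have "a * (\<mu>\<^sup>2 * (norm W)\<^sup>2) \<le> a * (norm x * (W \<bullet> (H x *v W)))"
    using WHW a_pos by (intro mult_left_mono) auto
  also have "\<dots> \<le> F x * (W \<bullet> (H x *v W))"
    using mult_right_mono[OF lower[of x] WHW0] by (simp add: mult.assoc)
  finally have tang: "a * \<mu>\<^sup>2 * (norm W)\<^sup>2 \<le> F x * (V \<bullet> (H x *v V))" by (simp add: VH mult.assoc)
  have De: "DF x \<bullet> e \<ge> a"
  proof -
    have "DF x \<bullet> e = F x / norm x" using euler[OF x] by (simp add: e_def sgn_div_norm divide_inverse)
    then show ?thesis using lower[of x] x by (simp add: le_divide_eq)
  qed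
  define p q where "p = \<alpha> * (DF x \<bullet> e)" and "q = DF x \<bullet> W"
  have DV: "DF x \<bullet> V = p + q" unfolding V p_def q_def by (simp add: inner_add_right)
  have p2: "a\<^sup>2 * \<alpha>\<^sup>2 \<le> p\<^sup>2"
    unfolding p_def power_mult_distrib using De a_pos
    by (metis mult.commute mult_right_mono power_mono less_eq_real_def zero_le_power2)
  have q2: "q\<^sup>2 \<le> b\<^sup>2 * (norm W)\<^sup>2"
    using abs_DF_le[OF x, of W] unfolding q_def
    by (metis abs_ge_zero power2_abs power_mono power_mult_distrib)
  \<comment> \<open>The difference of the two sides is
    \<open>(p + 2 * q)\<^sup>2 / 2\<close>.\<close>
  have "p\<^sup>2 / 2 - q\<^sup>2 \<le> (p + q)\<^sup>2"
    using zero_le_power2[of "p + 2 * q"] by (simp add: power2_eq_square algebra_simps)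
  then have rad: "a\<^sup>2 * \<alpha>\<^sup>2 / 2 - b\<^sup>2 * (norm W)\<^sup>2 \<le> (DF x \<bullet> V)\<^sup>2"
    unfolding DV using p2 q2 by linarith
  have "\<theta> * (a\<^sup>2 * \<alpha>\<^sup>2 / 2 - b\<^sup>2 * (norm W)\<^sup>2) \<le> \<theta> * (DF x \<bullet> V)\<^sup>2"
    using rad \<theta> by (intro mult_left_mono) auto
  also have "\<dots> \<le> 1 * (DF x \<bullet> V)\<^sup>2" using \<theta> by (intro mult_right_mono) auto
  finally have 1: "\<theta> * a\<^sup>2 / 2 * \<alpha>\<^sup>2 - (\<theta> * b\<^sup>2) * (norm W)\<^sup>2 \<le> (DF x \<bullet> V)\<^sup>2"
    by (simp add: algebra_simps)
  have 2: "(\<theta> * b\<^sup>2) * (norm W)\<^sup>2 \<le> a * \<mu>\<^sup>2 / 2 * (norm W)\<^sup>2" using \<theta> by (intro mult_right_mono) auto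
  have 3: "convexity_const * \<alpha>\<^sup>2 \<le> \<theta> * a\<^sup>2 / 2 * \<alpha>\<^sup>2"
    "convexity_const * (norm W)\<^sup>2 \<le> a * \<mu>\<^sup>2 / 2 * (norm W)\<^sup>2"
    unfolding convexity_const_def by (intro mult_right_mono; simp)+
  show ?thesis unfolding nV distrib_left using 1 2 3 tang by (simp add: field_simps)
qed

section \<open>Midpoint convexity along lines\<close>

lemma has_derivative_along_line:
  assumes "x + t *\<^sub>R V \<noteq> 0"
  shows "((\<lambda>t. F (x + t *\<^sub>R V)) has_real_derivative DF (x + t *\<^sub>R V) \<bullet> V) (at t)"
    and "((\<lambda>t. DF (x + t *\<^sub>R V) \<bullet> V) has_real_derivative V \<bullet> (H (x + t *\<^sub>R V) *v V)) (at t)"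
proof -
  have "((\<lambda>t. F (x + t *\<^sub>R V)) has_derivative (\<lambda>s. DF (x + t *\<^sub>R V) \<bullet> (s *\<^sub>R V))) (at t)"
    by (rule has_derivative_compose[where g = F and f = "\<lambda>t. x + t *\<^sub>R V"])
       (use DF[OF assms] in \<open>auto intro!: derivative_eq_intros\<close>)
  then show "((\<lambda>t. F (x + t *\<^sub>R V)) has_real_derivative DF (x + t *\<^sub>R V) \<bullet> V) (at t)"
    by (simp add: has_field_derivative_def mult_commute_abs)
  have "((\<lambda>t. DF (x + t *\<^sub>R V)) has_derivative (\<lambda>s. H (x + t *\<^sub>R V) *v (s *\<^sub>R V))) (at t)"
    by (rule has_derivative_compose[where g = DF and f = "\<lambda>t. x + t *\<^sub>R V"])
       (use H[OF assms] in \<open>auto intro!: derivative_eq_intros\<close>)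
  from has_derivative_inner_left[OF this, of V]
  show "((\<lambda>t. DF (x + t *\<^sub>R V) \<bullet> V) has_real_derivative V \<bullet> (H (x + t *\<^sub>R V) *v V)) (at t)"
    by (simp add: has_field_derivative_def mult_commute_abs matrix_vector_mult_scaleR inner_commute)
qed

lemma midpoint_convex_off_origin:
  assumes nz: "\<And>t::real. x + t *\<^sub>R V \<noteq> 0"
  shows "(F (x + (1/2) *\<^sub>R V))\<^sup>2 \<le> (F x)\<^sup>2 / 2 + (F (x + V))\<^sup>2 / 2 - convexity_const / 4 * (norm V)\<^sup>2"
proof -
  define c where "c = convexity_const * (norm V)\<^sup>2"
  define p where "p t = F (x + t *\<^sub>R V)" for t
  define p1 where "p1 t = DF (x + t *\<^sub>R V) \<bullet> V" for t
  define p2 where "p2 t = V \<bullet> (H (x + t *\<^sub>R V) *v V)" for t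
  note p_deriv = has_derivative_along_line(1)[OF nz, folded p_def p1_def]
  note p1_deriv = has_derivative_along_line(2)[OF nz, folded p1_def p2_def]
  \<comment> \<open>The second derivative of \<open>(p t)\<^sup>2\<close> is twice the Hessian form,
    hence at least \<open>2 * c\<close>. At the midpoint of 0 and 1 the subtracted parabola
    contributes \<open>c / 2 - c / 4\<close>, which is the gain in the claim. Asking that the whole
    line avoid the origin makes this an argument on all of the reals.\<close>
  have "convex_on UNIV (\<lambda>t. (p t)\<^sup>2 - c * t\<^sup>2)"
  proof (rule f''_ge0_imp_convex)
    fix t :: real
    show "((\<lambda>t. (p t)\<^sup>2 - c * t\<^sup>2) has_real_derivative (2 * p t * p1 t - 2 * c * t)) (at t)"
      by (auto intro!: derivative_eq_intros p_deriv)
    show "((\<lambda>t. 2 * p t * p1 t - 2 * c * t) has_real_derivative (2 * ((p1 t)\<^sup>2 + p t * p2 t) - 2 * c)) (at t)"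
      by (auto intro!: derivative_eq_intros p_deriv p1_deriv simp: power2_eq_square algebra_simps)
    show "0 \<le> 2 * ((p1 t)\<^sup>2 + p t * p2 t) - 2 * c"
      using hessian_half_square_ge[OF nz[of t], of V] by (simp add: p_def p1_def p2_def c_def)
  qed auto
  from convex_onD[OF this, of "1/2" 0 1]
  have "(p (1/2))\<^sup>2 - c * (1/2)\<^sup>2 \<le> (1/2) * (p 0)\<^sup>2 + (1/2) * ((p 1)\<^sup>2 - c)" by simp
  then show ?thesis by (simp add: p_def c_def power2_eq_square field_simps)
qed

lemma midpoint_convex:
  "(F ((1/2) *\<^sub>R (x + y)))\<^sup>2 \<le> (F x)\<^sup>2 / 2 + (F y)\<^sup>2 / 2 - convexity_const / 4 * (norm (x - y))\<^sup>2"
proof -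
  define V where "V = y - x"
  have y: "y = x + V" and mid: "(1/2) *\<^sub>R (x + y) = x + (1/2) *\<^sub>R V"
    by (auto simp: V_def vec_eq_iff field_simps)
  have nV: "norm (x - y) = norm V" by (simp add: V_def norm_minus_commute)
  show ?thesis
  proof (cases "\<exists>t::real. x + t *\<^sub>R V = 0")
    case False
    then show ?thesis using midpoint_convex_off_origin[of x V] unfolding mid nV by (simp add: y)
  next
    case True
    then obtain t where t: "x + t *\<^sub>R V = 0" by auto
    then have x: "x = (- t) *\<^sub>R V" by (simp add: eq_neg_iff_add_eq_0)
    \<comment> \<open>On a line through the origin the square of \<open>F\<close> is an exact
      quadratic polynomial, although \<open>F\<close> has a kink there. Its midpoint gain is
      \<open>(F V)\<^sup>2 / 4\<close>.\<close>
    have Fs: "(F (x + s *\<^sub>R V))\<^sup>2 = (s - t)\<^sup>2 * (F V)\<^sup>2" for s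
    proof -
      have "x + s *\<^sub>R V = (s - t) *\<^sub>R V" by (simp add: x scaleR_diff_left)
      then show ?thesis by (simp only: hom power_mult_distrib power2_abs)
    qed
    have "convexity_const * (norm V)\<^sup>2 \<le> (F V)\<^sup>2"
    proof -
      have "convexity_const * (norm V)\<^sup>2 \<le> (a * norm V)\<^sup>2"
        unfolding power_mult_distrib by (intro mult_right_mono convexity_const_le) auto
      also have "\<dots> \<le> (F V)\<^sup>2" using lower a_pos by (intro power_mono) auto
      finally show ?thesis .
    qed
    then show ?thesis
      unfolding mid nV using Fs[of 0] Fs[of 1] Fs[of "1/2"]
      by (simp add: y power2_eq_square algebra_simps)
  qed
qed

text \<open>Squaring removes the kink at the origin, where the function becomes
  \<open>t\<^sup>2 * (F V)\<^sup>2\<close>. This matters because the gradient of the minimizer may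
  vanish on a large set.\<close>

lemma square_directional_derivative:
  "\<exists>D. ((\<lambda>t. (F (x + t *\<^sub>R V))\<^sup>2) has_real_derivative D) (at 0)"
proof (cases "x = 0")
  case True
  have "((\<lambda>t. t\<^sup>2 * (F V)\<^sup>2) has_real_derivative 0) (at 0)" by (auto intro!: derivative_eq_intros)
  then show ?thesis using True by (auto simp: hom power_mult_distrib)
next
  case False
  then show ?thesis
    using DERIV_power[OF has_derivative_along_line(1)[of x 0 V], of 2] by auto
qed

end

lemma admissible_F_imp_finsler_hessian:
  assumes "admissible_F F"
  obtains DF H a b \<mu> where "finsler_hessian F DF H a b \<mu>"
proof -
  obtain a b where ab: "0 < a" "a \<le> b" "\<And>x. a * norm x \<le> F x" "\<And>x. F x \<le> b * norm x"
    using admissible_F_bounds[OF assms] by metis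
  obtain DF H \<mu> \<Lambda> where D:
    "\<forall>\<xi>. \<xi> \<noteq> 0 \<longrightarrow> (F has_derivative (\<lambda>v. DF \<xi> \<bullet> v)) (at \<xi>) \<and>
                          (DF has_derivative (\<lambda>v. H \<xi> *v v)) (at \<xi>)"
    "0 < \<mu>"
    "\<forall>\<xi> V. norm \<xi> = 1 \<and> V \<bullet> \<xi> = 0 \<longrightarrow>
            \<mu>\<^sup>2 * (norm V)\<^sup>2 \<le> V \<bullet> (H \<xi> *v V) \<and> V \<bullet> (H \<xi> *v V) \<le> \<Lambda> * (norm V)\<^sup>2"
    using assms unfolding admissible_F_def by blast
  have "finsler_hessian F DF H a b \<mu>"
    using assms admissible_F_subadditive[OF assms] ab D
    by unfold_locales (auto simp: admissible_F_def)
  then show ?thesis by (rule that)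
qed

lemma admissible_F_strongly_convex:
  assumes "admissible_F F"
  obtains \<kappa> where "0 < \<kappa>"
    "\<And>x y. (F ((1/2) *\<^sub>R (x + y)))\<^sup>2 \<le> (F x)\<^sup>2 / 2 + (F y)\<^sup>2 / 2 - \<kappa> * (norm (x - y))\<^sup>2"
proof -
  obtain DF H a b \<mu> where "finsler_hessian F DF H a b \<mu>"
    by (rule admissible_F_imp_finsler_hessian[OF assms])
  then interpret finsler_hessian F DF H a b \<mu> .
  show ?thesis
    using that[of "convexity_const / 4"] convexity_const_pos midpoint_convex by auto
qed

lemma admissible_F_square_directional_derivative:
  assumes "admissible_F F"
  obtains D where "((\<lambda>t. (F (x + t *\<^sub>R V))\<^sup>2) has_real_derivative D) (at 0)"
  using finsler_hessian.square_directional_derivative admissible_F_imp_finsler_hessian[OF assms]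
  by metis

section \<open>Test functions\<close>

lemma smooth2_has_derivative:
  assumes "smooth2 f"
  shows "(f has_derivative (\<lambda>v. grad f x \<bullet> v)) (at x)"
proof -
  have "f differentiable (at x)" using assms by (cases rule: smooth2.cases) auto
  then have D: "(f has_derivative frechet_derivative f (at x)) (at x)"
    by (simp add: frechet_derivative_works)
  then interpret bounded_linear "frechet_derivative f (at x)" by (rule has_derivative_bounded_linear)
  have "frechet_derivative f (at x) v = grad f x \<bullet> v" for v
  proof -
    have "v = (\<Sum>i\<in>UNIV. (v $ i) *\<^sub>R axis i 1)"
      using basis_expansion[of v] by (simp add: scalar_mult_eq_scaleR)
    then have "frechet_derivative f (at x) v = frechet_derivative f (at x) (\<Sum>i\<in>UNIV. (v $ i) *\<^sub>R axis i 1)"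
      by (rule arg_cong)
    also have "\<dots> = (\<Sum>i\<in>UNIV. v $ i * frechet_derivative f (at x) (axis i 1))"
      by (simp only: sum scaleR real_scaleR_def)
    finally show ?thesis by (simp add: inner_vec_def grad_def mult.commute)
  qed
  then have "frechet_derivative f (at x) = (\<lambda>v. grad f x \<bullet> v)" by blast
  then show ?thesis using D by simp
qed

lemma grad_eqI:
  assumes "(f has_derivative (\<lambda>v. g \<bullet> v)) (at x)"
  shows "grad f x = g"
  by (simp add: grad_def vec_eq_iff frechet_derivative_at[OF assms, symmetric] inner_axis)

lemma smooth2_continuous: "smooth2 f \<Longrightarrow> continuous_on UNIV f"
  by (meson continuous_at_imp_continuous_on has_derivative_continuous smooth2_has_derivative)

lemma smooth2_continuous_grad:
  assumes "smooth2 f"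
  shows "continuous_on UNIV (grad f)"
proof -
  have "smooth2 (\<lambda>x. frechet_derivative f (at x) (axis i 1))" for i
    using assms by (cases rule: smooth2.cases) auto
  then show ?thesis unfolding grad_def[abs_def]
    by (intro continuous_on_vec_lambda smooth2_continuous)
qed

lemma grad_lincomb:
  assumes "smooth2 f" "smooth2 g"
  shows "grad (\<lambda>x. c * f x + d * g x) x = c *\<^sub>R grad f x + d *\<^sub>R grad g x"
  by (rule grad_eqI)
     (auto intro!: derivative_eq_intros smooth2_has_derivative assms simp: inner_add_left)

lemma smooth2_lincomb:
  assumes "smooth2 f" "smooth2 g"
  shows "smooth2 (\<lambda>x. c * f x + d * g x)"
proof -
  \<comment> \<open>The coinduction invariant keeps \<open>c\<close> and \<open>d\<close> fixed and
    lets the two functions vary, since partial derivatives act on the functions alone.\<close>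
  define X where "X h \<longleftrightarrow> (\<exists>f g. smooth2 f \<and> smooth2 g \<and> h = (\<lambda>x. c * f x + d * g x))" for h
  have "X (\<lambda>x. c * f x + d * g x)" using assms X_def by auto
  then show ?thesis
  proof (coinduct rule: smooth2.coinduct)
    case (smooth2 h)
    then obtain f g where fg: "smooth2 f" "smooth2 g" "h = (\<lambda>x. c * f x + d * g x)"
      unfolding X_def by auto
    have "((\<lambda>x. c * f x + d * g x) has_derivative (\<lambda>v. c * (grad f x \<bullet> v) + d * (grad g x \<bullet> v))) (at x)" for x
      by (auto intro!: derivative_eq_intros smooth2_has_derivative fg)
    then have 1: "\<forall>x. h differentiable at x" unfolding fg differentiable_def by blast
    have "frechet_derivative h (at x) (axis i 1) = c * frechet_derivative f (at x) (axis i 1)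
        + d * frechet_derivative g (at x) (axis i 1)" for x i
      using grad_lincomb[OF fg(1,2), of c d x] unfolding fg(3) by (simp add: grad_def vec_eq_iff)
    moreover have "smooth2 (\<lambda>x. frechet_derivative f (at x) (axis i 1))"
      "smooth2 (\<lambda>x. frechet_derivative g (at x) (axis i 1))" for i
      using fg by (auto elim: smooth2.cases)
    moreover have "X (\<lambda>x. c * p x + d * q x)" if "smooth2 p" "smooth2 q" for p q
      using that X_def by blast
    ultimately have "\<forall>i. X (\<lambda>x. frechet_derivative h (at x) (axis i 1))" by simp
    with 1 show ?case by blast
  qed
qed

lemma test_fun_lincomb:
  assumes "test_fun \<Omega> f" "test_fun \<Omega> g"
  shows "test_fun \<Omega> (\<lambda>x. c * f x + d * g x)"
proof -
  let ?h = "\<lambda>x. c * f x + d * g x"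
  have "{x. ?h x \<noteq> 0} \<subseteq> {x. f x \<noteq> 0} \<union> {x. g x \<noteq> 0}" by auto
  then have sub: "closure {x. ?h x \<noteq> 0} \<subseteq> closure {x. f x \<noteq> 0} \<union> closure {x. g x \<noteq> 0}"
    unfolding closure_Un[symmetric] by (rule closure_mono)
  moreover have "compact (closure {x. f x \<noteq> 0} \<union> closure {x. g x \<noteq> 0})"
    using assms by (auto simp: test_fun_def intro: compact_Un)
  ultimately have "compact (closure {x. ?h x \<noteq> 0})"
    unfolding compact_eq_bounded_closed using bounded_subset closed_closure by blast
  then show ?thesis
    using sub assms smooth2_lincomb[of f g] unfolding test_fun_def by auto
qed

lemma test_fun_eq_0: "test_fun \<Omega> f \<Longrightarrow> x \<notin> \<Omega> \<Longrightarrow> f x = 0"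
  unfolding test_fun_def using closure_subset[of "{x. f x \<noteq> 0}"] by auto

lemma test_fun_grad_eq_0:
  assumes "test_fun \<Omega> f" "x \<notin> \<Omega>"
  shows "grad f x = 0"
proof (rule grad_eqI)
  have "x \<in> - closure {x. f x \<noteq> 0}" using assms unfolding test_fun_def by auto
  then have "((\<lambda>x. f x) has_derivative (\<lambda>v. 0)) (at x)"
    by (rule has_derivative_transform_within_open[OF has_derivative_const[of 0], rotated])
       (use closure_subset[of "{x. f x \<noteq> 0}"] in auto)
  then show "(f has_derivative (\<bullet>) 0) (at x)" by (simp add: inner_zero_left[abs_def])
qed

section \<open>An explicit smooth bump function\<close>

definition flat_exp :: "nat \<Rightarrow> real \<Rightarrow> real" where
  "flat_exp k t = (if t > 0 then exp (- (1 / t)) / t ^ k else 0)"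

lemma flat_exp_tendsto_0: "(flat_exp k \<longlongrightarrow> 0) (at 0)"
proof (rule filterlim_split_at)
  have "((\<lambda>t. (inverse t) ^ k / exp (inverse t)) \<longlongrightarrow> 0) (at_right (0::real))"
    by (rule filterlim_compose[OF tendsto_power_div_exp_0 filterlim_inverse_at_top_right])
  then show "(flat_exp k \<longlongrightarrow> 0) (at_right 0)"
    by (rule Lim_transform_eventually)
       (auto simp: eventually_at_right_field flat_exp_def exp_minus field_simps intro!: exI[of _ 1])
  show "(flat_exp k \<longlongrightarrow> 0) (at_left 0)"
    by (rule tendsto_eventually)
       (auto simp: eventually_at_left_field flat_exp_def intro!: exI[of _ "-1"])
qed

text \<open>This formula explains the index \<open>k\<close>: the derivative stays in the span of
  the family, so all derivatives of the flat function \<open>exp (- (1 / t))\<close> are covered at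
  once.\<close>

lemma flat_exp_has_derivative:
  "(flat_exp k has_real_derivative - real k * flat_exp (k + 1) t + flat_exp (k + 2) t) (at t)"
proof -
  consider "t > 0" | "t = 0" | "t < 0" by linarith
  then show ?thesis
  proof cases
    case 1
    have "((\<lambda>t. exp (- (1 / t)) / t ^ k) has_real_derivative
        - real k * flat_exp (k + 1) t + flat_exp (k + 2) t) (at t)"
    proof (cases k)
      case 0
      then show ?thesis using 1
        by (auto intro!: derivative_eq_intros simp: flat_exp_def power2_eq_square field_simps)
    next
      case (Suc m)
      show ?thesis unfolding Suc using 1
        by (auto intro!: derivative_eq_intros simp: flat_exp_def power2_eq_square field_simps)
           (cases m; simp)
    qed
    then show ?thesis
      by (rule has_field_derivative_transform_within_open[where S = "{0<..}"]) (use 1 in \<open>auto simp: flat_exp_def\<close>)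
  next
    case 2
    \<comment> \<open>The difference quotient at 0 is itself \<open>flat_exp (k + 1) h\<close>,
      which tends to 0 from both sides.\<close>
    have "((\<lambda>h. (flat_exp k (0 + h) - flat_exp k 0) / h) \<longlongrightarrow> 0) (at 0)"
      by (rule Lim_transform_eventually[OF flat_exp_tendsto_0[of "k + 1"]])
         (auto simp: flat_exp_def eventually_at intro!: exI[of _ 1])
    then show ?thesis using 2 by (simp add: DERIV_def flat_exp_def)
  next
    case 3
    have "((\<lambda>t. 0) has_real_derivative - real k * flat_exp (k + 1) t + flat_exp (k + 2) t) (at t)"
      using 3 by (auto simp: flat_exp_def)
    then show ?thesis
      by (rule has_field_derivative_transform_within_open[where S = "{..<0}"]) (use 3 in \<open>auto simp: flat_exp_def\<close>)
  qed
qed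

text \<open>Smoothness is coinductive, so proving it calls for a class of functions closed under
  partial derivatives. This algebra is such a class: differentiating a generator yields other
  generators times coordinates and constants.\<close>

inductive bump_algebra :: "real^2 \<Rightarrow> real \<Rightarrow> (real^2 \<Rightarrow> real) \<Rightarrow> bool" for z r where
  const: "bump_algebra z r (\<lambda>x. c)"
| coord: "bump_algebra z r (\<lambda>x. x $ i)"
| gen: "bump_algebra z r (\<lambda>x. flat_exp k (r\<^sup>2 - (norm (x - z))\<^sup>2))"
| add: "bump_algebra z r f \<Longrightarrow> bump_algebra z r g \<Longrightarrow> bump_algebra z r (\<lambda>x. f x + g x)"
| mult: "bump_algebra z r f \<Longrightarrow> bump_algebra z r g \<Longrightarrow> bump_algebra z r (\<lambda>x. f x * g x)"

lemma bump_algebra_has_derivative: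
  assumes "bump_algebra z r f"
  shows "\<exists>g. (\<forall>i. bump_algebra z r (\<lambda>x. g x $ i)) \<and> (\<forall>x. (f has_derivative (\<lambda>v. g x \<bullet> v)) (at x))"
  using assms
proof induction
  case (const c)
  show ?case
    by (rule exI[of _ "\<lambda>x. 0"]) (auto intro: bump_algebra.const)
next
  case (coord i)
  have "((\<lambda>x. x $ i) has_derivative (\<lambda>v. axis i 1 \<bullet> v)) (at x)" for x :: "real^2"
    using bounded_linear_imp_has_derivative[OF bounded_linear_vec_nth[of i], of "at x"]
    by (simp add: inner_axis' )
  then show ?case
    by (intro exI[of _ "\<lambda>x. axis i 1"]) (auto intro: bump_algebra.const)
next
  case (gen k)
  define s where "s x = r\<^sup>2 - (norm (x - z))\<^sup>2" for x
  define c where "c x = - real k * flat_exp (k + 1) (s x) + flat_exp (k + 2) (s x)" for x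
  define g where "g x = (- 2 * c x) *\<^sub>R (x - z)" for x
  have "((\<lambda>x. flat_exp k (s x)) has_derivative (\<lambda>v. g x \<bullet> v)) (at x)" for x
  proof -
    have "(s has_derivative (\<lambda>v. - 2 * ((x - z) \<bullet> v))) (at x)"
      unfolding s_def[abs_def] power2_norm_eq_inner
      by (auto intro!: derivative_eq_intros simp: inner_commute)
    from has_derivative_compose[OF this flat_exp_has_derivative[unfolded has_field_derivative_def, of k "s x"]]
    show ?thesis by (simp add: g_def c_def algebra_simps)
  qed
  moreover have "bump_algebra z r (\<lambda>x. g x $ i)" for i
  proof -
    have "bump_algebra z r (\<lambda>x. (- 2 * (- real k * flat_exp (k + 1) (r\<^sup>2 - (norm (x - z))\<^sup>2)
       + flat_exp (k + 2) (r\<^sup>2 - (norm (x - z))\<^sup>2))) * (x $ i + - (z $ i)))"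
      by (intro bump_algebra.intros)
    then show ?thesis by (simp add: g_def c_def s_def)
  qed
  ultimately show ?case unfolding s_def by blast
next
  case (add f1 f2)
  then obtain g1 g2 where g:
    "\<And>i. bump_algebra z r (\<lambda>x. g1 x $ i)" "\<And>x. (f1 has_derivative (\<lambda>v. g1 x \<bullet> v)) (at x)"
    "\<And>i. bump_algebra z r (\<lambda>x. g2 x $ i)" "\<And>x. (f2 has_derivative (\<lambda>v. g2 x \<bullet> v)) (at x)"
    by blast
  show ?case
    by (rule exI[of _ "\<lambda>x. g1 x + g2 x"])
       (auto intro!: g derivative_eq_intros bump_algebra.add simp: inner_add_left)
next
  case (mult f1 f2)
  then obtain g1 g2 where g:
    "\<And>i. bump_algebra z r (\<lambda>x. g1 x $ i)" "\<And>x. (f1 has_derivative (\<lambda>v. g1 x \<bullet> v)) (at x)"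
    "\<And>i. bump_algebra z r (\<lambda>x. g2 x $ i)" "\<And>x. (f2 has_derivative (\<lambda>v. g2 x \<bullet> v)) (at x)"
    by blast
  show ?case
    by (rule exI[of _ "\<lambda>x. f1 x *\<^sub>R g2 x + f2 x *\<^sub>R g1 x"])
       (auto intro!: g mult derivative_eq_intros bump_algebra.add bump_algebra.mult
          simp: inner_add_left)
qed

text \<open>Closure of the algebra under partial derivatives is precisely the invariant that the
  coinduction asks for.\<close>

lemma bump_algebra_smooth2:
  assumes "bump_algebra z r f"
  shows "smooth2 f"
  using assms
proof (coinduct rule: smooth2.coinduct)
  case (smooth2 f)
  then obtain g where g: "\<And>i. bump_algebra z r (\<lambda>x. g x $ i)" "\<And>x. (f has_derivative (\<lambda>v. g x \<bullet> v)) (at x)"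
    using bump_algebra_has_derivative by blast
  have "frechet_derivative f (at x) (axis i 1) = g x $ i" for x i
    using frechet_derivative_at[OF g(2), symmetric] by (simp add: inner_axis)
  then show ?case using g(1) differentiableI[OF g(2)] by auto
qed

text \<open>Supplies the direction of descent. The set \<open>S\<close> with the lower bound
  \<open>c\<close> is there to make the integral of the bump strictly positive.\<close>

lemma exists_bump_test_fun:
  fixes \<Omega> :: "(real^2) set"
  assumes "open \<Omega>" "\<Omega> \<noteq> {}"
  obtains \<phi> c S where "test_fun \<Omega> \<phi>" "\<And>x. 0 \<le> \<phi> x" "0 < c" "S \<in> lmeasurable" "S \<subseteq> \<Omega>"
    "0 < measure lebesgue S" "\<And>x. x \<in> S \<Longrightarrow> c \<le> \<phi> x"
proof -
  obtain z where "z \<in> \<Omega>" using assms by auto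
  then obtain r where r: "0 < r" "cball z r \<subseteq> \<Omega>" using assms open_contains_cball by blast
  define \<phi> where "\<phi> x = flat_exp 0 (r\<^sup>2 - (norm (x - z))\<^sup>2)" for x
  have "{x. \<phi> x \<noteq> 0} \<subseteq> cball z r"
  proof
    fix x assume "x \<in> {x. \<phi> x \<noteq> 0}"
    then have "(norm (x - z))\<^sup>2 < r\<^sup>2" by (auto simp: \<phi>_def flat_exp_def split: if_splits)
    then show "x \<in> cball z r" using r by (auto simp: dist_norm norm_minus_commute dest: power_less_imp_less_base)
  qed
  then have cl: "closure {x. \<phi> x \<noteq> 0} \<subseteq> cball z r" by (simp add: closure_minimal)
  then have "compact (closure {x. \<phi> x \<noteq> 0})"
    by (metis bounded_cball bounded_subset closed_closure compact_eq_bounded_closed)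
  moreover have "smooth2 \<phi>"
    unfolding \<phi>_def by (rule bump_algebra_smooth2) (rule bump_algebra.gen)
  ultimately have "test_fun \<Omega> \<phi>" using cl r by (auto simp: test_fun_def)
  \<comment> \<open>On the half ball the argument of \<open>flat_exp 0\<close> exceeds
    \<open>r\<^sup>2 - (r / 2)\<^sup>2\<close>, and \<open>exp (- (1 / t))\<close> increases with
    \<open>t > 0\<close>.\<close>
  moreover have "exp (- (1 / (r\<^sup>2 - (r / 2)\<^sup>2))) \<le> \<phi> x" if "x \<in> ball z (r / 2)" for x
  proof -
    have "(norm (x - z))\<^sup>2 < (r / 2)\<^sup>2"
      using that by (intro power_strict_mono) (auto simp: dist_norm norm_minus_commute)
    moreover have "(r / 2)\<^sup>2 < r\<^sup>2" using r by (intro power_strict_mono) auto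
    ultimately show ?thesis
      by (auto simp: \<phi>_def flat_exp_def intro!: divide_left_mono mult_pos_pos)
  qed
  moreover have "0 < measure lebesgue (ball z (r / 2))" using content_ball_pos[of "r / 2" z] r by simp
  moreover have "ball z (r / 2) \<subseteq> \<Omega>" using r by (auto simp: subset_eq)
  ultimately show ?thesis
    by (intro that[of \<phi> "exp (- (1 / (r\<^sup>2 - (r / 2)\<^sup>2)))" "ball z (r / 2)"])
       (auto simp: \<phi>_def flat_exp_def)
qed

section \<open>Exponential integrability\<close>

definition plane_point :: "real \<Rightarrow> real \<Rightarrow> real^2" where
  "plane_point s t = s *\<^sub>R axis 1 1 + t *\<^sub>R axis 2 1"

lemma plane_point_nth [simp]: "plane_point s t $ 1 = s" "plane_point s t $ 2 = t"
  by (simp_all add: plane_point_def axis_def)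

lemma borel_measurable_plane_point [measurable]:
  "(\<lambda>p. plane_point (fst p) (snd p)) \<in> borel_measurable (borel \<Otimes>\<^sub>M borel)"
  unfolding plane_point_def by measurable

text \<open>Both measures give a box the product of its side lengths, which characterizes Lebesgue
  measure. The identification opens the way to Tonelli in either order.\<close>

lemma lborel_plane:
  "(lborel :: (real^2) measure) = distr (lborel \<Otimes>\<^sub>M lborel) borel (\<lambda>p. plane_point (fst p) (snd p))"
proof (rule lborel_eqI)
  fix l u :: "real^2"
  assume lu: "\<And>b. b \<in> Basis \<Longrightarrow> l \<bullet> b \<le> u \<bullet> b"
  have basis: "(Basis :: (real^2) set) = {axis 1 1, axis 2 1}"
    by (auto simp: Basis_vec_def UNIV_2)
  have le: "l $ 1 \<le> u $ 1" "l $ 2 \<le> u $ 2"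
    using lu[of "axis 1 1"] lu[of "axis 2 1"] by (auto simp: basis inner_axis)
  have ne: "axis 1 1 \<noteq> (axis 2 1 :: real^2)" by (simp add: axis_eq_axis)
  have "(\<lambda>p. plane_point (fst p) (snd p)) -` box l u \<inter> space (lborel \<Otimes>\<^sub>M lborel)
      = box (l $ 1) (u $ 1) \<times> box (l $ 2) (u $ 2)"
    by (auto simp: box_def basis inner_axis space_pair_measure)
  then have "emeasure (distr (lborel \<Otimes>\<^sub>M lborel) borel (\<lambda>p. plane_point (fst p) (snd p))) (box l u)
    = emeasure (lborel \<Otimes>\<^sub>M lborel) (box (l $ 1) (u $ 1) \<times> box (l $ 2) (u $ 2))"
    by (subst emeasure_distr) auto
  also have "\<dots> = ennreal (u $ 1 - l $ 1) * ennreal (u $ 2 - l $ 2)"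
    using le by (subst lborel.emeasure_pair_measure_Times) auto
  also have "\<dots> = ennreal (\<Prod>b\<in>Basis. (u - l) \<bullet> b)"
    using le ne by (simp add: basis inner_axis ennreal_mult)
  finally show "emeasure (distr (lborel \<Otimes>\<^sub>M lborel) borel (\<lambda>p. plane_point (fst p) (snd p))) (box l u)
    = (\<Prod>b\<in>Basis. (u - l) \<bullet> b)" .
qed simp

lemma
  fixes f :: "real^2 \<Rightarrow> ennreal"
  assumes [measurable]: "f \<in> borel_measurable borel"
  shows nn_integral_plane: "(\<integral>\<^sup>+x. f x \<partial>lborel) = (\<integral>\<^sup>+s. \<integral>\<^sup>+t. f (plane_point s t) \<partial>lborel \<partial>lborel)"
    and nn_integral_plane': "(\<integral>\<^sup>+x. f x \<partial>lborel) = (\<integral>\<^sup>+t. \<integral>\<^sup>+s. f (plane_point s t) \<partial>lborel \<partial>lborel)"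
proof -
  have m: "(\<lambda>p. f (plane_point (fst p) (snd p))) \<in> borel_measurable (lborel \<Otimes>\<^sub>M lborel)" by measurable
  have eq: "(\<integral>\<^sup>+x. f x \<partial>lborel) = (\<integral>\<^sup>+p. f (plane_point (fst p) (snd p)) \<partial>(lborel \<Otimes>\<^sub>M lborel))"
    by (subst lborel_plane, subst nn_integral_distr) auto
  show "(\<integral>\<^sup>+x. f x \<partial>lborel) = (\<integral>\<^sup>+s. \<integral>\<^sup>+t. f (plane_point s t) \<partial>lborel \<partial>lborel)"
    unfolding eq by (subst lborel.nn_integral_fst[OF m, symmetric]) simp
  show "(\<integral>\<^sup>+x. f x \<partial>lborel) = (\<integral>\<^sup>+t. \<integral>\<^sup>+s. f (plane_point s t) \<partial>lborel \<partial>lborel)"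
    unfolding eq by (subst lborel_pair.nn_integral_snd[OF m, symmetric]) simp
qed

lemma abs_le_nn_integral_deriv:
  fixes p p' :: "real \<Rightarrow> real"
  assumes deriv: "\<And>s. (p has_real_derivative p' s) (at s)"
    and cont: "continuous_on UNIV p'"
    and supp: "\<And>s. R \<le> \<bar>s\<bar> \<Longrightarrow> p s = 0"
  shows "ennreal \<bar>p s\<bar> \<le> (\<integral>\<^sup>+\<sigma>. ennreal \<bar>p' \<sigma>\<bar> \<partial>lborel)"
proof -
  \<comment> \<open>A starting point to the left of \<open>s\<close> and outside the support, so the
    fundamental theorem of calculus on \<open>{a..s}\<close> has no boundary term at
    \<open>a\<close>.\<close>
  define a where "a = - \<bar>s\<bar> - \<bar>R\<bar>"
  have a: "a \<le> s" "p a = 0" by (auto simp: a_def intro!: supp)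
  have c: "continuous_on {a..s} p'" using cont continuous_on_subset by blast
  have d: "\<And>x. a \<le> x \<Longrightarrow> x \<le> s \<Longrightarrow> (p has_vector_derivative p' x) (at x within {a..s})"
    using deriv has_real_derivative_iff_has_vector_derivative has_vector_derivative_at_within by blast
  note bi = has_bochner_integral_FTC_Icc[OF a(1) d c]
  have "ennreal \<bar>p s\<bar> = ennreal (norm (\<integral>x. indicator {a..s} x *\<^sub>R p' x \<partial>lborel))"
    using has_bochner_integral_integral_eq[OF bi] a by simp
  also have "\<dots> \<le> (\<integral>\<^sup>+x. norm (indicator {a..s} x *\<^sub>R p' x) \<partial>lborel)"
    using bi by (intro integral_norm_bound_ennreal) (auto simp: has_bochner_integral_iff)
  also have "\<dots> \<le> (\<integral>\<^sup>+\<sigma>. ennreal \<bar>p' \<sigma>\<bar> \<partial>lborel)"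
    by (intro nn_integral_mono) (auto split: split_indicator)
  finally show ?thesis .
qed

text \<open>Bound \<open>\<bar>w(s,t)\<bar>\<close> once by the integral of \<open>\<bar>\<nabla>w\<bar>\<close> along the horizontal and once along the
  vertical line through \<open>(s,t)\<close>; the product of the two bounds has separated variables.\<close>
lemma sobolev_W11_L2:
  fixes w :: "real^2 \<Rightarrow> real" and G :: "real^2 \<Rightarrow> real^2"
  assumes deriv: "\<And>x. (w has_derivative (\<lambda>v. G x \<bullet> v)) (at x)"
    and cont: "continuous_on UNIV G"
    and supp: "\<And>x. R \<le> norm x \<Longrightarrow> w x = 0"
  shows "(\<integral>\<^sup>+x. ennreal ((w x)\<^sup>2) \<partial>lborel) \<le> (\<integral>\<^sup>+x. ennreal (norm (G x)) \<partial>lborel)\<^sup>2"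
proof -
  have [measurable]: "G \<in> borel_measurable borel" using cont by (simp add: borel_measurable_continuous_onI)
  have "continuous_on UNIV w"
    by (meson continuous_at_imp_continuous_on has_derivative_continuous deriv)
  then have [measurable]: "w \<in> borel_measurable borel" by (simp add: borel_measurable_continuous_onI)
  define X where "X t = (\<integral>\<^sup>+s. ennreal (norm (G (plane_point s t))) \<partial>lborel)" for t
  define Y where "Y s = (\<integral>\<^sup>+t. ennreal (norm (G (plane_point s t))) \<partial>lborel)" for s
  have [measurable]: "X \<in> borel_measurable borel" "Y \<in> borel_measurable borel"
    unfolding X_def[abs_def] Y_def[abs_def] plane_point_def by measurable
  have nx: "R \<le> \<bar>x $ i\<bar> \<Longrightarrow> w x = 0" for x i
    using component_le_norm_cart[of x i] supp[of x] by linarith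
  have wX: "ennreal \<bar>w (plane_point s t)\<bar> \<le> X t" for s t
  proof -
    have "((\<lambda>s. w (plane_point s t)) has_derivative (\<lambda>h. G (plane_point s t) \<bullet> (h *\<^sub>R axis 1 1))) (at s)" for s
      by (rule has_derivative_compose[where g = w, OF _ deriv])
         (auto simp: plane_point_def intro!: derivative_eq_intros)
    then have d: "((\<lambda>s. w (plane_point s t)) has_real_derivative G (plane_point s t) $ 1) (at s)" for s
      by (simp add: has_field_derivative_def inner_axis mult_commute_abs)
    have "continuous_on UNIV (\<lambda>s. G (plane_point s t) $ 1)"
      by (intro continuous_intros continuous_on_compose2[OF cont]) (auto simp: plane_point_def intro!: continuous_intros)
    then have "ennreal \<bar>w (plane_point s t)\<bar> \<le> (\<integral>\<^sup>+s. ennreal \<bar>G (plane_point s t) $ 1\<bar> \<partial>lborel)"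
      by (intro abs_le_nn_integral_deriv[where R = R, OF d]) (use nx[of "plane_point _ t" 1] in auto)
    also have "\<dots> \<le> X t" unfolding X_def by (intro nn_integral_mono ennreal_leI component_le_norm_cart)
    finally show ?thesis .
  qed
  have wY: "ennreal \<bar>w (plane_point s t)\<bar> \<le> Y s" for s t
  proof -
    have "((\<lambda>t. w (plane_point s t)) has_derivative (\<lambda>h. G (plane_point s t) \<bullet> (h *\<^sub>R axis 2 1))) (at t)" for t
      by (rule has_derivative_compose[where g = w, OF _ deriv])
         (auto simp: plane_point_def intro!: derivative_eq_intros)
    then have d: "((\<lambda>t. w (plane_point s t)) has_real_derivative G (plane_point s t) $ 2) (at t)" for t
      by (simp add: has_field_derivative_def inner_axis mult_commute_abs)
    have "continuous_on UNIV (\<lambda>t. G (plane_point s t) $ 2)"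
      by (intro continuous_intros continuous_on_compose2[OF cont]) (auto simp: plane_point_def intro!: continuous_intros)
    then have "ennreal \<bar>w (plane_point s t)\<bar> \<le> (\<integral>\<^sup>+t. ennreal \<bar>G (plane_point s t) $ 2\<bar> \<partial>lborel)"
      by (intro abs_le_nn_integral_deriv[where R = R, OF d]) (use nx[of "plane_point s _" 2] in auto)
    also have "\<dots> \<le> Y s" unfolding Y_def by (intro nn_integral_mono ennreal_leI component_le_norm_cart)
    finally show ?thesis .
  qed
  have "(\<integral>\<^sup>+x. ennreal ((w x)\<^sup>2) \<partial>lborel) = (\<integral>\<^sup>+s. \<integral>\<^sup>+t. ennreal ((w (plane_point s t))\<^sup>2) \<partial>lborel \<partial>lborel)"
    by (rule nn_integral_plane) measurable
  also have "\<dots> \<le> (\<integral>\<^sup>+s. \<integral>\<^sup>+t. Y s * X t \<partial>lborel \<partial>lborel)"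
  proof (intro nn_integral_mono)
    fix s t
    have "ennreal ((w (plane_point s t))\<^sup>2) = ennreal \<bar>w (plane_point s t)\<bar> * ennreal \<bar>w (plane_point s t)\<bar>"
      by (simp add: ennreal_mult[symmetric] power2_eq_square)
    also have "\<dots> \<le> Y s * X t" by (intro mult_mono wX wY) auto
    finally show "ennreal ((w (plane_point s t))\<^sup>2) \<le> Y s * X t" .
  qed
  also have "\<dots> = (\<integral>\<^sup>+s. Y s \<partial>lborel) * (\<integral>\<^sup>+t. X t \<partial>lborel)"
    by (simp add: nn_integral_cmult nn_integral_multc)
  also have "(\<integral>\<^sup>+s. Y s \<partial>lborel) = (\<integral>\<^sup>+x. ennreal (norm (G x)) \<partial>lborel)"
    unfolding Y_def by (rule nn_integral_plane[symmetric]) measurable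
  also have "(\<integral>\<^sup>+t. X t \<partial>lborel) = (\<integral>\<^sup>+x. ennreal (norm (G x)) \<partial>lborel)"
    unfolding X_def by (rule nn_integral_plane'[symmetric]) measurable
  finally show ?thesis by (simp add: power2_eq_square)
qed

lemma integrable_mult_of_squares:
  fixes f g :: "'a \<Rightarrow> real"
  assumes [measurable]: "f \<in> borel_measurable M" "g \<in> borel_measurable M"
    and "integrable M (\<lambda>x. (f x)\<^sup>2)" "integrable M (\<lambda>x. (g x)\<^sup>2)"
  shows "integrable M (\<lambda>x. f x * g x)"
proof (rule Bochner_Integration.integrable_bound)
  show "integrable M (\<lambda>x. (f x)\<^sup>2 + (g x)\<^sup>2)" using assms by auto
  have "\<bar>p * q\<bar> \<le> p\<^sup>2 + q\<^sup>2" for p q :: real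
  proof -
    have "2 * (\<bar>p\<bar> * \<bar>q\<bar>) \<le> p\<^sup>2 + q\<^sup>2" using sum_squares_bound[of "\<bar>p\<bar>" "\<bar>q\<bar>"] by simp
    moreover have "0 \<le> \<bar>p\<bar> * \<bar>q\<bar>" by simp
    ultimately show ?thesis unfolding abs_mult by linarith
  qed
  then show "AE x in M. norm (f x * g x) \<le> norm ((f x)\<^sup>2 + (g x)\<^sup>2)" by simp
qed measurable

text \<open>The integral of \<open>(f x - c * g x)\<^sup>2\<close> is a nonnegative quadratic
  polynomial in \<open>c\<close>; its value at \<open>Q / S\<close> is the claim divided by
  \<open>S\<close>.\<close>

lemma integral_Cauchy_Schwarz:
  fixes f g :: "'a \<Rightarrow> real"
  assumes [measurable]: "f \<in> borel_measurable M" "g \<in> borel_measurable M"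
    and f2: "integrable M (\<lambda>x. (f x)\<^sup>2)" and g2: "integrable M (\<lambda>x. (g x)\<^sup>2)"
  shows "(LINT x|M. f x * g x)\<^sup>2 \<le> (LINT x|M. (f x)\<^sup>2) * (LINT x|M. (g x)\<^sup>2)"
proof -
  define P Q S where "P = (LINT x|M. (f x)\<^sup>2)" and "Q = (LINT x|M. f x * g x)" and "S = (LINT x|M. (g x)\<^sup>2)"
  have fg: "integrable M (\<lambda>x. f x * g x)" by (rule integrable_mult_of_squares) (use assms in auto)
  have key: "0 \<le> P - 2 * c * Q + c\<^sup>2 * S" for c
  proof -
    have "0 \<le> (LINT x|M. (f x - c * g x)\<^sup>2)" by simp
    also have "\<dots> = (LINT x|M. (f x)\<^sup>2 - (2 * c) * (f x * g x) + c\<^sup>2 * (g x)\<^sup>2)"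
      by (intro Bochner_Integration.integral_cong) (auto simp: power2_eq_square algebra_simps)
    also have "\<dots> = P - 2 * c * Q + c\<^sup>2 * S"
      using f2 g2 fg by (simp add: P_def Q_def S_def)
    finally show ?thesis .
  qed
  have S: "0 \<le> S" by (simp add: S_def)
  show ?thesis
  proof (cases "S = 0")
    case True
    have "Q = 0"
    proof (rule ccontr)
      \<comment> \<open>With \<open>S = 0\<close> the polynomial is affine in \<open>c\<close>, and
        the chosen \<open>c\<close> gives it the value -1.\<close>
      assume "Q \<noteq> 0"
      then show False using key[of "(P + 1) / (2 * Q)"] True by simp
    qed
    then show ?thesis using True by (simp add: P_def Q_def S_def)
  next
    case False
    then have "0 \<le> (P - 2 * (Q / S) * Q + (Q / S)\<^sup>2 * S) * S" using key[of "Q / S"] S by (intro mult_nonneg_nonneg)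
    also have "\<dots> = P * S - Q\<^sup>2" using False by (simp add: field_simps power2_eq_square)
    finally show ?thesis by (simp add: P_def Q_def S_def)
  qed
qed

lemma test_fun_bounded:
  assumes "test_fun \<Omega> \<phi>"
  obtains B where "\<And>x. \<bar>\<phi> x\<bar> \<le> B" "\<And>x. norm (grad \<phi> x) \<le> B"
proof -
  define K where "K = closure {x. \<phi> x \<noteq> 0}"
  have K: "compact K" and sm: "smooth2 \<phi>" using assms by (auto simp: test_fun_def K_def)
  have tK: "test_fun K \<phi>" using assms by (simp add: test_fun_def K_def)
  have "bounded (\<phi> ` K)" "bounded (grad \<phi> ` K)"
    using compact_continuous_image[OF continuous_on_subset K] smooth2_continuous[OF sm]
      smooth2_continuous_grad[OF sm] compact_imp_bounded by blast+
  then obtain B1 B2 where B: "\<And>x. x \<in> K \<Longrightarrow> \<bar>\<phi> x\<bar> \<le> B1" "\<And>x. x \<in> K \<Longrightarrow> norm (grad \<phi> x) \<le> B2"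
    unfolding bounded_iff by auto
  show ?thesis
  proof (rule that[of "max 0 (max B1 B2)"])
    fix x
    show "\<bar>\<phi> x\<bar> \<le> max 0 (max B1 B2)"
      using B(1)[of x] test_fun_eq_0[OF tK, of x] by (cases "x \<in> K") auto
    show "norm (grad \<phi> x) \<le> max 0 (max B1 B2)"
      using B(2)[of x] test_fun_grad_eq_0[OF tK, of x] by (cases "x \<in> K") auto
  qed
qed

section \<open>Moments of test functions and the exponential estimate\<close>

locale plane_domain =
  fixes \<Omega> :: "(real^2) set"
  assumes open_domain: "open \<Omega>" and bounded_domain: "bounded \<Omega>"
begin

abbreviation "M \<equiv> lebesgue_on \<Omega>"
abbreviation "vol \<equiv> measure lebesgue \<Omega>"

lemma domain_lmeasurable: "\<Omega> \<in> lmeasurable"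
  using open_domain bounded_domain by (simp add: lmeasurable_open)

lemma domain_sets [measurable, simp]: "\<Omega> \<in> sets lebesgue"
  using domain_lmeasurable by (simp add: fmeasurable_def)

sublocale finite_measure M
  by (rule finite_measure_lebesgue_on[OF domain_lmeasurable])

lemma measure_space: "measure M (space M) = vol"
  by (simp add: measure_restrict_space space_restrict_space)

lemma continuous_measurable [measurable]:
  "continuous_on UNIV f \<Longrightarrow> f \<in> borel_measurable M"
  by (simp add: borel_measurable_continuous_onI measurable_completion measurable_restrict_space1)

lemma integrable_continuous_bounded:
  fixes f :: "real^2 \<Rightarrow> 'b::euclidean_space"
  assumes "continuous_on UNIV f" "\<And>x. norm (f x) \<le> B"
  shows "integrable M f"
  by (rule integrable_const_bound[of _ B]) (use assms continuous_measurable in auto)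

text \<open>The embedding is proved by Tonelli on \<open>lborel\<close>, the energy lives on
  Lebesgue measure restricted to the domain; functions vanishing outside may be moved between the
  two.\<close>

lemma nn_integral_eq_lborel:
  assumes [measurable]: "f \<in> borel_measurable borel" and "\<And>x. x \<notin> \<Omega> \<Longrightarrow> f x = 0"
  shows "(\<integral>\<^sup>+x. f x \<partial>M) = (\<integral>\<^sup>+x. f x \<partial>lborel)"
proof -
  have "(\<integral>\<^sup>+x. f x \<partial>M) = (\<integral>\<^sup>+x. f x * indicator \<Omega> x \<partial>lebesgue)"
    by (rule nn_integral_restrict_space) simp
  also have "\<dots> = (\<integral>\<^sup>+x. f x \<partial>lebesgue)"
    using assms by (intro nn_integral_cong) (auto split: split_indicator)
  also have "\<dots> = (\<integral>\<^sup>+x. f x \<partial>lborel)"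
    by (rule nn_integral_completion)
  finally show ?thesis .
qed

context
  fixes \<phi> assumes test: "test_fun \<Omega> \<phi>"
begin

lemma test_continuous: "continuous_on UNIV \<phi>" "continuous_on UNIV (grad \<phi>)"
  using test smooth2_continuous smooth2_continuous_grad by (auto simp: test_fun_def)

lemma test_integrable_power_grad: "integrable M (\<lambda>x. \<bar>\<phi> x\<bar> ^ k * norm (grad \<phi> x) ^ l)"
proof -
  obtain B where B: "\<And>x. \<bar>\<phi> x\<bar> \<le> B" "\<And>x. norm (grad \<phi> x) \<le> B"
    using test_fun_bounded[OF test] by metis
  show ?thesis
    by (rule integrable_continuous_bounded[of _ "B ^ k * B ^ l"])
       (auto intro!: continuous_intros test_continuous mult_mono power_mono B order_trans[OF _ B(1)] zero_le_power
          simp: abs_mult power_abs)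
qed

lemma test_integrable_power: "integrable M (\<lambda>x. \<phi> x ^ (2 * k))"
  using test_integrable_power_grad[of "2 * k" 0] by (simp add: power_mult)

lemma test_integrable_grad_sq: "integrable M (\<lambda>x. (norm (grad \<phi> x))\<^sup>2)"
  using test_integrable_power_grad[of 0 2] by simp

lemma test_integrable_exp: "integrable M (\<lambda>x. exp (s * \<bar>\<phi> x\<bar>))" "integrable M (\<lambda>x. exp (s * \<phi> x))"
proof -
  obtain B where B: "\<And>x. \<bar>\<phi> x\<bar> \<le> B" using test_fun_bounded[OF test] by metis
  have b: "s * p \<le> \<bar>s\<bar> * B" if "\<bar>p\<bar> \<le> B" for p
    using that abs_ge_self[of "s * p"] mult_left_mono[OF that abs_ge_zero[of s]] by (simp add: abs_mult)
  show "integrable M (\<lambda>x. exp (s * \<bar>\<phi> x\<bar>))" "integrable M (\<lambda>x. exp (s * \<phi> x))"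
    by (rule integrable_continuous_bounded[of _ "exp (\<bar>s\<bar> * B)"];
        auto intro!: continuous_intros test_continuous b B)+
qed

text \<open>The embedding for \<open>w = \<phi> ^ Suc k\<close> bounds the moment by the squared L1
  norm of \<open>Suc k * \<phi> ^ k * grad \<phi>\<close>. Cauchy-Schwarz then separates the
  gradient from \<open>\<phi> ^ k\<close>, whose square is the preceding even moment.\<close>

lemma moment_step:
  "(LINT x|M. \<phi> x ^ (2 * Suc k))
    \<le> (real (Suc k))\<^sup>2 * (LINT x|M. (norm (grad \<phi> x))\<^sup>2) * (LINT x|M. \<phi> x ^ (2 * k))"
proof -
  define w where "w x = \<phi> x ^ Suc k" for x
  define G where "G x = (real (Suc k) * \<phi> x ^ k) *\<^sub>R grad \<phi> x" for x
  have sm: "smooth2 \<phi>" using test by (simp add: test_fun_def)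
  have deriv: "(w has_derivative (\<lambda>v. G x \<bullet> v)) (at x)" for x
    unfolding w_def G_def
    by (rule has_derivative_eq_rhs[OF has_derivative_power[OF smooth2_has_derivative[OF sm]]])
       (auto simp: fun_eq_iff)
  have contG: "continuous_on UNIV G" unfolding G_def by (intro continuous_intros test_continuous)
  have contw: "continuous_on UNIV w" unfolding w_def by (intro continuous_intros test_continuous)
  obtain R where R: "\<And>x. x \<in> \<Omega> \<Longrightarrow> norm x < R" using bounded_domain by (metis bounded_pos_less)
  have supp: "R \<le> norm x \<Longrightarrow> w x = 0" for x
    using test_fun_eq_0[OF test, of x] R[of x] by (auto simp: w_def)
  have nG: "norm (G x) = real (Suc k) * (\<bar>\<phi> x\<bar> ^ k * norm (grad \<phi> x))" for x
    by (simp add: G_def abs_mult power_abs)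
  have iG: "integrable M (\<lambda>x. norm (G x))"
    unfolding nG using test_integrable_power_grad[of k 1] by simp
  have w2: "(w x)\<^sup>2 = \<phi> x ^ (2 * Suc k)" for x by (simp add: w_def power_mult[symmetric] mult.commute del: power_Suc)
  have iw: "integrable M (\<lambda>x. (w x)\<^sup>2)" unfolding w2 by (rule test_integrable_power)
  have "ennreal (LINT x|M. (w x)\<^sup>2) = (\<integral>\<^sup>+x. ennreal ((w x)\<^sup>2) \<partial>M)"
    by (rule nn_integral_eq_integral[symmetric, OF iw]) auto
  also have "\<dots> = (\<integral>\<^sup>+x. ennreal ((w x)\<^sup>2) \<partial>lborel)"
  proof (rule nn_integral_eq_lborel)
    have [measurable]: "w \<in> borel_measurable borel" using contw by (rule borel_measurable_continuous_onI)
    show "(\<lambda>x. ennreal ((w x)\<^sup>2)) \<in> borel_measurable borel" by measurable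
    show "x \<notin> \<Omega> \<Longrightarrow> ennreal ((w x)\<^sup>2) = 0" for x
      using test_fun_eq_0[OF test, of x] by (simp add: w_def)
  qed
  also have "\<dots> \<le> (\<integral>\<^sup>+x. ennreal (norm (G x)) \<partial>lborel)\<^sup>2"
    by (rule sobolev_W11_L2[OF deriv contG supp])
  also have "(\<integral>\<^sup>+x. ennreal (norm (G x)) \<partial>lborel) = (\<integral>\<^sup>+x. ennreal (norm (G x)) \<partial>M)"
  proof (rule nn_integral_eq_lborel[symmetric])
    have [measurable]: "G \<in> borel_measurable borel" using contG by (rule borel_measurable_continuous_onI)
    show "(\<lambda>x. ennreal (norm (G x))) \<in> borel_measurable borel" by measurable
    show "x \<notin> \<Omega> \<Longrightarrow> ennreal (norm (G x)) = 0" for x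
      using test_fun_grad_eq_0[OF test, of x] by (simp add: G_def)
  qed
  also have "\<dots> = ennreal (LINT x|M. norm (G x))"
    by (rule nn_integral_eq_integral[OF iG]) auto
  also have "(ennreal (LINT x|M. norm (G x)))\<^sup>2 = ennreal ((LINT x|M. norm (G x))\<^sup>2)"
    by (simp add: ennreal_power)
  finally have "(LINT x|M. (w x)\<^sup>2) \<le> (LINT x|M. norm (G x))\<^sup>2" by simp
  also have "\<dots> = (real (Suc k))\<^sup>2 * (LINT x|M. \<bar>\<phi> x\<bar> ^ k * norm (grad \<phi> x))\<^sup>2"
    unfolding nG by (simp add: power_mult_distrib del: of_nat_Suc)
  also have "(LINT x|M. \<bar>\<phi> x\<bar> ^ k * norm (grad \<phi> x))\<^sup>2
      \<le> (LINT x|M. (\<bar>\<phi> x\<bar> ^ k)\<^sup>2) * (LINT x|M. (norm (grad \<phi> x))\<^sup>2)"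
  proof (rule integral_Cauchy_Schwarz)
    show "integrable M (\<lambda>x. (\<bar>\<phi> x\<bar> ^ k)\<^sup>2)"
      using test_integrable_power_grad[of "2 * k" 0] by (simp add: power_mult[symmetric] mult.commute)
  qed (auto intro!: continuous_measurable continuous_intros test_continuous test_integrable_grad_sq)
  also have "(\<lambda>x. (\<bar>\<phi> x\<bar> ^ k)\<^sup>2) = (\<lambda>x. \<phi> x ^ (2 * k))"
    by (simp add: power_mult fun_eq_iff power_mult_distrib[symmetric] power_abs[symmetric])
       (simp add: power_mult[symmetric] mult.commute)
  finally show ?thesis unfolding w2 by (simp add: mult_left_mono algebra_simps del: of_nat_Suc power_Suc)
qed

text \<open>Besides feeding the exponential series, \<open>k = 1\<close> is the Poincare inequality
  and \<open>k = 2\<close> the L4 bound behind \<open>weighted_sq_bound\<close>.\<close>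

lemma moment_bound:
  "(LINT x|M. \<phi> x ^ (2 * k)) \<le> (fact k)\<^sup>2 * (LINT x|M. (norm (grad \<phi> x))\<^sup>2) ^ k * vol"
proof (induction k)
  case 0
  show ?case using measure_space by simp
next
  case (Suc k)
  let ?D = "LINT x|M. (norm (grad \<phi> x))\<^sup>2"
  have "(LINT x|M. \<phi> x ^ (2 * Suc k)) \<le> (real (Suc k))\<^sup>2 * ?D * (LINT x|M. \<phi> x ^ (2 * k))"
    by (rule moment_step)
  also have "\<dots> \<le> (real (Suc k))\<^sup>2 * ?D * ((fact k)\<^sup>2 * ?D ^ k * vol)"
    by (intro mult_left_mono Suc) auto
  also have "\<dots> = (fact (Suc k))\<^sup>2 * ?D ^ Suc k * vol"
    by (simp add: power_mult_distrib[symmetric] algebra_simps)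
  finally show ?case .
qed

lemma exp_moment_bound:
  assumes s: "s\<^sup>2 * (LINT x|M. (norm (grad \<phi> x))\<^sup>2) \<le> 1 / 2"
  shows "(LINT x|M. exp (s * \<bar>\<phi> x\<bar>)) \<le> 4 * vol"
proof -
  define D where "D = (LINT x|M. (norm (grad \<phi> x))\<^sup>2)"
  have D0: "0 \<le> D" by (simp add: D_def)
  \<comment> \<open>Terms of \<open>2 * cosh (s * \<phi> x)\<close>, which dominates
    \<open>exp (s * \<bar>\<phi> x\<bar>)\<close> and contains even powers only, so the even moments
    suffice.\<close>
  define f where "f k x = 2 * ((s * \<phi> x) ^ (2 * k) / fact (2 * k))" for k x
  have f0: "0 \<le> f k x" for k x by (simp add: f_def)
  have fsums: "(\<lambda>k. f k x) sums (2 * cosh (s * \<phi> x))" for x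
  proof -
    have "(\<lambda>n. if even n then (s * \<phi> x) ^ n /\<^sub>R fact n else 0) sums cosh (s * \<phi> x)" by (rule cosh_converges)
    moreover have "strict_mono (\<lambda>k::nat. 2 * k)" by (simp add: strict_mono_def)
    moreover have "n \<notin> range (\<lambda>k. 2 * k) \<Longrightarrow> odd n" for n :: nat by (auto elim!: evenE)
    ultimately have "(\<lambda>k. (s * \<phi> x) ^ (2 * k) /\<^sub>R fact (2 * k)) sums cosh (s * \<phi> x)"
      using sums_mono_reindex[of "\<lambda>k. 2 * k" "\<lambda>n. if even n then (s * \<phi> x) ^ n /\<^sub>R fact n else 0"]
      by auto
    from sums_mult[OF this, of 2] show ?thesis by (simp add: f_def divide_inverse mult.commute)
  qed
  have bound: "exp (s * \<bar>\<phi> x\<bar>) \<le> 2 * cosh (s * \<phi> x)" for x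
    by (cases "0 \<le> \<phi> x") (auto simp: cosh_def)
  have fint: "integrable M (f k)" for k
    unfolding f_def power_mult_distrib using test_integrable_power[of k] by auto
  have fI: "(LINT x|M. f k x) \<le> 2 * vol * (1 / 2) ^ k" for k
  proof -
    have "(LINT x|M. f k x) = 2 * (s ^ (2 * k) / fact (2 * k)) * (LINT x|M. \<phi> x ^ (2 * k))"
      unfolding f_def power_mult_distrib by simp
    also have "\<dots> \<le> 2 * (s ^ (2 * k) / fact (2 * k)) * ((fact k)\<^sup>2 * D ^ k * vol)"
      unfolding D_def by (intro mult_left_mono moment_bound) auto
    also have "\<dots> = 2 * vol * ((fact k)\<^sup>2 / fact (2 * k)) * (s\<^sup>2 * D) ^ k"
      by (simp add: power_mult power_mult_distrib)
    \<comment> \<open>The quotient \<open>(fact k)\<^sup>2 / fact (2 * k)\<close> is the reciprocal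
      of a central binomial coefficient. The geometric series left over sums to
      \<open>4 * vol\<close>.\<close>
    also have "\<dots> \<le> 2 * vol * 1 * (1 / 2) ^ k"
    proof (intro mult_mono power_mono)
      have "fact k * fact (2 * k - k) * (2 * k choose k) = (fact (2 * k) :: nat)"
        by (rule binomial_fact_lemma) simp
      then have "fact k * fact k * real (2 * k choose k) = fact (2 * k)"
        by (metis (no_types, lifting) add_diff_cancel_left' mult_2 of_nat_fact of_nat_mult)
      moreover have "1 \<le> real (2 * k choose k)"
        using zero_less_binomial[of k "2 * k"] by linarith
      ultimately have "(fact k)\<^sup>2 * 1 \<le> (fact (2 * k) :: real)"
        by (metis mult_left_mono power2_eq_square zero_le_power2)
      then show "(fact k)\<^sup>2 / fact (2 * k) \<le> (1::real)" by simp
    qed (use s D0 in \<open>auto simp: D_def\<close>)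
    finally show ?thesis by simp
  qed
  have "ennreal (LINT x|M. exp (s * \<bar>\<phi> x\<bar>)) = (\<integral>\<^sup>+x. ennreal (exp (s * \<bar>\<phi> x\<bar>)) \<partial>M)"
    by (rule nn_integral_eq_integral[symmetric]) (auto intro: test_integrable_exp)
  also have "\<dots> \<le> (\<integral>\<^sup>+x. (\<Sum>k. ennreal (f k x)) \<partial>M)"
  proof (intro nn_integral_mono)
    fix x
    have "(\<Sum>k. ennreal (f k x)) = ennreal (2 * cosh (s * \<phi> x))"
      using fsums[of x] f0 by (metis sums_unique suminf_ennreal2 sums_summable)
    then show "ennreal (exp (s * \<bar>\<phi> x\<bar>)) \<le> (\<Sum>k. ennreal (f k x))"
      using bound by (simp add: ennreal_leI)
  qed
  also have "\<dots> = (\<Sum>k. \<integral>\<^sup>+x. ennreal (f k x) \<partial>M)"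
    using fint by (intro nn_integral_suminf) auto
  also have "\<dots> = (\<Sum>k. ennreal (LINT x|M. f k x))"
    using fint f0 by (simp add: nn_integral_eq_integral)
  also have "\<dots> \<le> (\<Sum>k. ennreal (2 * vol * (1 / 2) ^ k))"
    by (intro suminf_le ennreal_leI fI) auto
  also have "\<dots> = ennreal (\<Sum>k. 2 * vol * (1 / 2) ^ k)"
    by (intro suminf_ennreal2) (auto intro!: summable_mult summable_geometric)
  also have "(\<Sum>k. 2 * vol * (1 / 2) ^ k) = 4 * vol"
    by (subst suminf_mult) (auto simp: suminf_geometric)
  finally show ?thesis by (simp add: ennreal_le_iff)
qed

end

end

section \<open>Square-integrable functions\<close>

lemma norm_add_sq_le:
  fixes x y :: "'a::real_normed_vector"
  shows "(norm (x + y))\<^sup>2 \<le> 2 * (norm x)\<^sup>2 + 2 * (norm y)\<^sup>2"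
proof -
  have "(norm (x + y))\<^sup>2 \<le> (norm x + norm y)\<^sup>2" by (intro power_mono norm_triangle_ineq) auto
  also have "\<dots> \<le> 2 * (norm x)\<^sup>2 + 2 * (norm y)\<^sup>2"
    using sum_squares_bound[of "norm x" "norm y"] by (simp add: power2_sum)
  finally show ?thesis .
qed

lemma integrable_norm_sq_add:
  fixes f g :: "'a \<Rightarrow> 'b::{banach, second_countable_topology}"
  assumes [measurable]: "f \<in> borel_measurable M" "g \<in> borel_measurable M"
    and "integrable M (\<lambda>x. (norm (f x))\<^sup>2)" "integrable M (\<lambda>x. (norm (g x))\<^sup>2)"
  shows "integrable M (\<lambda>x. (norm (f x + g x))\<^sup>2)"
proof (rule Bochner_Integration.integrable_bound)
  show "integrable M (\<lambda>x. 2 * (norm (f x))\<^sup>2 + 2 * (norm (g x))\<^sup>2)" using assms by auto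
qed (use norm_add_sq_le in auto)

lemma integral_norm_sq_add_le:
  fixes f g :: "'a \<Rightarrow> 'b::{banach, second_countable_topology}"
  assumes "f \<in> borel_measurable M" "g \<in> borel_measurable M"
    and "integrable M (\<lambda>x. (norm (f x))\<^sup>2)" "integrable M (\<lambda>x. (norm (g x))\<^sup>2)"
  shows "(LINT x|M. (norm (f x + g x))\<^sup>2) \<le> 2 * (LINT x|M. (norm (f x))\<^sup>2) + 2 * (LINT x|M. (norm (g x))\<^sup>2)"
proof -
  have "(LINT x|M. (norm (f x + g x))\<^sup>2) \<le> (LINT x|M. 2 * (norm (f x))\<^sup>2 + 2 * (norm (g x))\<^sup>2)"
    using assms by (intro integral_mono integrable_norm_sq_add norm_add_sq_le) auto
  then show ?thesis using assms by simp
qed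

lemma integrable_norm_sq_diff:
  fixes f g :: "'a \<Rightarrow> 'b::{banach, second_countable_topology}"
  assumes "f \<in> borel_measurable M" "g \<in> borel_measurable M"
    and "integrable M (\<lambda>x. (norm (f x))\<^sup>2)" "integrable M (\<lambda>x. (norm (g x))\<^sup>2)"
  shows "integrable M (\<lambda>x. (norm (f x - g x))\<^sup>2)"
  using integrable_norm_sq_add[of f M "\<lambda>x. - g x"] assms by simp

text \<open>Fatou's lemma in terms of real integrals. Integrability of the limit is part of the
  conclusion, which is how limits of test functions acquire exponential moments.\<close>

lemma integral_Fatou:
  fixes p :: "nat \<Rightarrow> 'a \<Rightarrow> real"
  assumes int: "\<And>k. integrable M (p k)" and nn: "\<And>k x. 0 \<le> p k x"
    and C: "\<forall>\<^sub>F k in sequentially. (LINT x|M. p k x) \<le> C"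
    and lim: "AE x in M. (\<lambda>k. p k x) \<longlonglongrightarrow> q x"
    and [measurable]: "q \<in> borel_measurable M" and q0: "\<And>x. 0 \<le> q x"
  shows "integrable M q" "(LINT x|M. q x) \<le> C"
proof -
  have [measurable]: "\<And>k. p k \<in> borel_measurable M" using int by auto
  obtain k where "(LINT x|M. p k x) \<le> C" using C by (auto simp: eventually_sequentially)
  moreover have "0 \<le> (LINT x|M. p k x)" using nn by simp
  ultimately have C0: "0 \<le> C" by linarith
  have "(\<integral>\<^sup>+x. ennreal (q x) \<partial>M) = (\<integral>\<^sup>+x. liminf (\<lambda>k. ennreal (p k x)) \<partial>M)"
  proof (intro nn_integral_cong_AE)
    show "AE x in M. ennreal (q x) = liminf (\<lambda>k. ennreal (p k x))"
      using lim
    proof eventually_elim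
      case (elim x)
      then have "(\<lambda>k. ennreal (p k x)) \<longlonglongrightarrow> ennreal (q x)" by (rule tendsto_ennrealI)
      then show ?case using lim_imp_Liminf[OF sequentially_bot] by metis
    qed
  qed
  also have "\<dots> \<le> liminf (\<lambda>k. \<integral>\<^sup>+x. ennreal (p k x) \<partial>M)" by (rule nn_integral_liminf) auto
  also have "\<dots> = liminf (\<lambda>k. ennreal (LINT x|M. p k x))"
    using int nn by (simp add: nn_integral_eq_integral)
  also have "\<dots> \<le> ennreal C"
  proof -
    have "liminf (\<lambda>k. ennreal (LINT x|M. p k x)) \<le> liminf (\<lambda>k::nat. ennreal C)"
      by (rule Liminf_mono) (use C in \<open>auto elim!: eventually_mono intro: ennreal_leI\<close>)
    then show ?thesis by (simp add: Liminf_const)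
  qed
  finally have le: "(\<integral>\<^sup>+x. ennreal (q x) \<partial>M) \<le> ennreal C" .
  then have "(\<integral>\<^sup>+x. ennreal (q x) \<partial>M) < \<infinity>" using le_less_trans ennreal_less_top by fastforce
  then show i: "integrable M q" using q0 by (intro integrableI_nonneg) auto
  show "(LINT x|M. q x) \<le> C"
    using le C0 unfolding nn_integral_eq_integral[OF i AE_I2[OF q0]] by (simp add: ennreal_le_iff)
qed

lemma AE_subseq_of_L2:
  fixes f :: "nat \<Rightarrow> 'a \<Rightarrow> real"
  assumes "\<And>n. integrable M (\<lambda>x. (f n x - u x)\<^sup>2)" "(\<lambda>n. LINT x|M. (f n x - u x)\<^sup>2) \<longlonglongrightarrow> 0"
  obtains r :: "nat \<Rightarrow> nat" where "strict_mono r" "AE x in M. (\<lambda>n. f (r n) x) \<longlonglongrightarrow> u x"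
proof -
  obtain r :: "nat \<Rightarrow> nat" where r: "strict_mono r" "AE x in M. (\<lambda>n. (f (r n) x - u x)\<^sup>2) \<longlonglongrightarrow> 0"
    using tendsto_L1_AE_subseq[of M "\<lambda>n x. (f n x - u x)\<^sup>2"] assms by auto
  have "AE x in M. (\<lambda>n. f (r n) x) \<longlonglongrightarrow> u x"
    using r(2)
  proof eventually_elim
    case (elim x)
    then have "(\<lambda>n. sqrt ((f (r n) x - u x)\<^sup>2)) \<longlonglongrightarrow> sqrt 0" by (intro tendsto_intros)
    then have "(\<lambda>n. f (r n) x - u x) \<longlonglongrightarrow> 0" by (simp add: tendsto_rabs_zero_iff)
    then show ?case by (simp add: LIM_zero_iff)
  qed
  with r(1) show ?thesis by (rule that)
qed

text \<open>On a finite measure space Cauchy-Schwarz against the constant 1 turns the L2 bounds into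
  L1 bounds of order \<open>(1 / 2) ^ n\<close>. The sum of all increments is then integrable, hence
  finite almost everywhere, and the sequence telescopes.\<close>

lemma (in finite_measure) AE_convergent_of_L2_summable:
  fixes f :: "nat \<Rightarrow> 'a \<Rightarrow> 'b::euclidean_space"
  assumes meas [measurable]: "\<And>n. f n \<in> borel_measurable M"
    and int: "\<And>n. integrable M (\<lambda>x. (norm (f (Suc n) x - f n x))\<^sup>2)"
    and le: "\<And>n. (LINT x|M. (norm (f (Suc n) x - f n x))\<^sup>2) \<le> (1 / 4) ^ n"
  shows "AE x in M. convergent (\<lambda>n. f n x)"
proof -
  define h where "h n x = norm (f (Suc n) x - f n x)" for n x
  define V where "V = measure M (space M)"
  have [measurable]: "h n \<in> borel_measurable M" for n unfolding h_def by measurable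
  have hi: "integrable M (h n)" for n
    using square_integrable_imp_integrable[of "h n"] int[of n] by (simp add: h_def)
  have hI: "(LINT x|M. h n x) \<le> sqrt V * (1 / 2) ^ n" for n
  proof -
    have "(LINT x|M. h n x * 1)\<^sup>2 \<le> (LINT x|M. (h n x)\<^sup>2) * (LINT x|M. 1\<^sup>2)"
      using int[of n] by (intro integral_Cauchy_Schwarz) (auto simp: h_def)
    also have "\<dots> \<le> (1 / 4) ^ n * V"
      using le[of n] by (simp add: h_def V_def mult_right_mono)
    also have "\<dots> = (sqrt V * (1 / 2) ^ n)\<^sup>2"
      by (simp add: V_def power_mult_distrib power2_eq_square power_divide flip: power_mult_distrib)
    finally show ?thesis by (simp add: V_def power2_le_iff_abs_le)
  qed
  have "(\<integral>\<^sup>+x. (\<Sum>n. ennreal (h n x)) \<partial>M) = (\<Sum>n. \<integral>\<^sup>+x. ennreal (h n x) \<partial>M)"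
    by (intro nn_integral_suminf) auto
  also have "\<dots> = (\<Sum>n. ennreal (LINT x|M. h n x))"
    by (intro suminf_cong nn_integral_eq_integral hi) (auto simp: h_def)
  also have "\<dots> \<le> (\<Sum>n. ennreal (sqrt V * (1 / 2) ^ n))" by (intro suminf_le ennreal_leI hI) auto
  also have "\<dots> = ennreal (\<Sum>n. sqrt V * (1 / 2) ^ n)"
    by (intro suminf_ennreal2) (auto simp: V_def intro!: summable_mult summable_geometric)
  finally have "(\<integral>\<^sup>+x. (\<Sum>n. ennreal (h n x)) \<partial>M) \<noteq> \<infinity>"
    using ennreal_less_top le_less_trans by (metis infinity_ennreal_def less_irrefl)
  then have "AE x in M. (\<Sum>n. ennreal (h n x)) \<noteq> \<infinity>" by (intro nn_integral_PInf_AE) auto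
  then show ?thesis
  proof eventually_elim
    case (elim x)
    then have "summable (\<lambda>n. h n x)" by (intro summable_suminf_not_top) (auto simp: h_def)
    then have "summable (\<lambda>n. f (Suc n) x - f n x)" unfolding h_def by (rule summable_norm_cancel)
    then have "convergent (\<lambda>n. \<Sum>k<n. f (Suc k) x - f k x)" by (simp add: summable_iff_convergent)
    then have "convergent (\<lambda>n. f n x - f 0 x)" using sum_lessThan_telescope[of "\<lambda>k. f k x"] by simp
    from convergent_add[OF this convergent_const[of "f 0 x"]] show ?case by simp
  qed
qed

lemma (in finite_measure) L2_complete:
  fixes f :: "nat \<Rightarrow> 'a \<Rightarrow> 'b::euclidean_space"
  assumes meas [measurable]: "\<And>n. f n \<in> borel_measurable M"
    and int: "\<And>n. integrable M (\<lambda>x. (norm (f n x))\<^sup>2)"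
    and cauchy: "\<And>e. 0 < e \<Longrightarrow> \<exists>N. \<forall>m\<ge>N. \<forall>n\<ge>N. (LINT x|M. (norm (f m x - f n x))\<^sup>2) \<le> e"
  obtains g where "g \<in> borel_measurable M" "integrable M (\<lambda>x. (norm (g x))\<^sup>2)"
    "(\<lambda>n. LINT x|M. (norm (f n x - g x))\<^sup>2) \<longlonglongrightarrow> 0"
proof -
  have "\<forall>k. \<exists>N. \<forall>m\<ge>N. \<forall>n\<ge>N. (LINT x|M. (norm (f m x - f n x))\<^sup>2) \<le> (1 / 4) ^ k"
    by (intro allI cauchy) auto
  then obtain N where N: "\<And>k m n. m \<ge> N k \<Longrightarrow> n \<ge> N k \<Longrightarrow>
      (LINT x|M. (norm (f m x - f n x))\<^sup>2) \<le> (1 / 4) ^ k" by metis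
  \<comment> \<open>The sum makes \<open>r\<close> monotone and at least \<open>N k\<close>; the
    summand \<open>k\<close> sends it to infinity.\<close>
  define r where "r k = k + (\<Sum>i\<le>k. N i)" for k
  have rN: "N k \<le> r k" for k unfolding r_def by (simp add: sum.atMost_Suc trans_le_add2 member_le_sum)
  have rS: "r k \<le> r (Suc k)" for k by (simp add: r_def)
  have rk: "k \<le> r k" for k by (simp add: r_def)
  have idiff: "integrable M (\<lambda>x. (norm (f m x - f n x))\<^sup>2)" for m n
    by (intro integrable_norm_sq_diff int meas)
  have conv: "AE x in M. convergent (\<lambda>k. f (r k) x)"
    by (rule AE_convergent_of_L2_summable) (auto intro!: idiff N rN order_trans[OF rN rS])
  \<comment> \<open>Where the subsequence diverges the value of \<open>lim\<close> is irrelevant, as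
    this is a null set; defining \<open>g\<close> everywhere makes it measurable.\<close>
  define g where "g x = lim (\<lambda>k. f (r k) x)" for x
  have [measurable]: "g \<in> borel_measurable M" unfolding g_def by measurable
  have lim: "AE x in M. (\<lambda>k. f (r k) x) \<longlonglongrightarrow> g x"
    using conv by eventually_elim (simp add: g_def convergent_LIMSEQ_iff)
  \<comment> \<open>Freeze \<open>n\<close> and let the other index run through the subsequence: the
    Cauchy bound survives by Fatou, so the full sequence converges.\<close>
  have fatou: "integrable M (\<lambda>x. (norm (f n x - g x))\<^sup>2) \<and> (LINT x|M. (norm (f n x - g x))\<^sup>2) \<le> e"
    if n: "\<And>m. m \<ge> K \<Longrightarrow> (LINT x|M. (norm (f n x - f m x))\<^sup>2) \<le> e" for n K e
  proof -
    have ev: "\<forall>\<^sub>F k in sequentially. (LINT x|M. (norm (f n x - f (r k) x))\<^sup>2) \<le> e"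
      using eventually_ge_at_top[of K] by eventually_elim (use n rk order_trans in blast)
    have ae: "AE x in M. (\<lambda>k. (norm (f n x - f (r k) x))\<^sup>2) \<longlonglongrightarrow> (norm (f n x - g x))\<^sup>2"
      using lim by eventually_elim (intro tendsto_intros)
    show ?thesis using integral_Fatou[OF idiff _ ev ae] by simp
  qed
  obtain K where K: "\<forall>m\<ge>K. \<forall>n\<ge>K. (LINT x|M. (norm (f m x - f n x))\<^sup>2) \<le> 1" using cauchy[of 1] by auto
  have iK: "integrable M (\<lambda>x. (norm (f K x - g x))\<^sup>2)"
    using fatou[of K K 1] K by auto
  have ig: "integrable M (\<lambda>x. (norm (g x))\<^sup>2)"
    using integrable_norm_sq_diff[of "f K" M "\<lambda>x. f K x - g x"] int[of K] iK by simp
  have "(\<lambda>n. LINT x|M. (norm (f n x - g x))\<^sup>2) \<longlonglongrightarrow> 0"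
  proof (rule LIMSEQ_I)
    fix e :: real assume e: "0 < e"
    obtain K where K: "\<forall>m\<ge>K. \<forall>n\<ge>K. (LINT x|M. (norm (f m x - f n x))\<^sup>2) \<le> e / 2"
      using cauchy[of "e / 2"] e by auto
    have "norm ((LINT x|M. (norm (f n x - g x))\<^sup>2) - 0) < e" if "n \<ge> K" for n
    proof -
      have "(LINT x|M. (norm (f n x - g x))\<^sup>2) \<le> e / 2" using fatou[of K n "e / 2"] K that by auto
      then show ?thesis using e by simp
    qed
    then show "\<exists>no. \<forall>n\<ge>no. norm ((LINT x|M. (norm (f n x - g x))\<^sup>2) - 0) < e" by blast
  qed
  with ig show ?thesis by (intro that[of g]) auto
qed

section \<open>Continuity and differentiation of integral functionals\<close>

lemma integral_mult_tendsto_0: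
  fixes p q :: "nat \<Rightarrow> 'a \<Rightarrow> real"
  assumes meas: "\<And>n. p n \<in> borel_measurable M" "\<And>n. q n \<in> borel_measurable M"
    and int: "\<And>n. integrable M (\<lambda>x. (p n x)\<^sup>2)" "\<And>n. integrable M (\<lambda>x. (q n x)\<^sup>2)"
    and p: "(\<lambda>n. LINT x|M. (p n x)\<^sup>2) \<longlonglongrightarrow> 0" and q: "\<And>n. (LINT x|M. (q n x)\<^sup>2) \<le> C"
  shows "(\<lambda>n. LINT x|M. p n x * q n x) \<longlonglongrightarrow> 0"
proof -
  have "(\<lambda>n. sqrt ((LINT x|M. (p n x)\<^sup>2) * C)) \<longlonglongrightarrow> sqrt (0 * C)" by (intro tendsto_intros p)
  then have "(\<lambda>n. sqrt ((LINT x|M. (p n x)\<^sup>2) * C)) \<longlonglongrightarrow> 0" by simp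
  then show ?thesis
  proof (rule tendsto_0_le[where K = 1], intro always_eventually allI)
    fix n
    have "(LINT x|M. p n x * q n x)\<^sup>2 \<le> (LINT x|M. (p n x)\<^sup>2) * (LINT x|M. (q n x)\<^sup>2)"
      by (intro integral_Cauchy_Schwarz meas int)
    also have "\<dots> \<le> (LINT x|M. (p n x)\<^sup>2) * C" by (intro mult_left_mono q) auto
    finally have "\<bar>LINT x|M. p n x * q n x\<bar> \<le> sqrt ((LINT x|M. (p n x)\<^sup>2) * C)"
      by (simp add: real_le_rsqrt)
    then show "norm (LINT x|M. p n x * q n x) \<le> norm (sqrt ((LINT x|M. (p n x)\<^sup>2) * C)) * 1" by simp
  qed
qed

text \<open>The increments of \<open>\<Phi>\<close> are dominated by a product of a factor tending
  to 0 in L2 and a factor bounded in L2. The instances are the squared norm and the square of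
  \<open>F\<close>.\<close>

lemma integral_quadratic_growth:
  fixes \<Phi> :: "'b::euclidean_space \<Rightarrow> real" and f :: "nat \<Rightarrow> 'a \<Rightarrow> 'b"
  assumes cont: "continuous_on UNIV \<Phi>" and \<Phi>0: "\<Phi> 0 = 0"
    and growth: "\<And>x y. \<bar>\<Phi> x - \<Phi> y\<bar> \<le> B * (norm (x - y) * (norm x + norm y))"
    and meas [measurable]: "\<And>n. f n \<in> borel_measurable M" "g \<in> borel_measurable M"
    and int: "\<And>n. integrable M (\<lambda>x. (norm (f n x))\<^sup>2)" "integrable M (\<lambda>x. (norm (g x))\<^sup>2)"
    and lim: "(\<lambda>n. LINT x|M. (norm (f n x - g x))\<^sup>2) \<longlonglongrightarrow> 0"
  shows "integrable M (\<lambda>x. \<Phi> (g x))" "(\<lambda>n. LINT x|M. \<Phi> (f n x)) \<longlonglongrightarrow> (LINT x|M. \<Phi> (g x))"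
proof -
  have [measurable]: "\<Phi> \<in> borel_measurable borel" using cont by (rule borel_measurable_continuous_onI)
  have i: "integrable M (\<lambda>x. \<Phi> (h x))"
    if [measurable]: "h \<in> borel_measurable M" and "integrable M (\<lambda>x. (norm (h x))\<^sup>2)" for h
  proof (rule Bochner_Integration.integrable_bound)
    show "integrable M (\<lambda>x. B * (norm (h x))\<^sup>2)" using that by auto
    have "\<bar>\<Phi> x\<bar> \<le> B * (norm x)\<^sup>2" for x
      using growth[of x 0] \<Phi>0 by (simp add: power2_eq_square)
    then show "AE x in M. norm (\<Phi> (h x)) \<le> norm (B * (norm (h x))\<^sup>2)"
      by (intro AE_I2) (metis abs_ge_self order_trans real_norm_def)
  qed measurable
  show ig: "integrable M (\<lambda>x. \<Phi> (g x))" using i meas int by auto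
  have idiff: "integrable M (\<lambda>x. (norm (f n x - g x))\<^sup>2)" for n
    by (intro integrable_norm_sq_diff meas int)
  define G where "G = (LINT x|M. (norm (g x))\<^sup>2)"
  obtain C where C: "\<And>n. (LINT x|M. (norm (f n x - g x))\<^sup>2) \<le> C"
    using convergent_imp_Bseq[OF convergentI[OF lim]] unfolding Bseq_def
    by (metis abs_le_D1 real_norm_def)
  have fb: "(LINT x|M. (norm (f n x))\<^sup>2) \<le> 2 * C + 2 * G" for n
  proof -
    have "(LINT x|M. (norm ((f n x - g x) + g x))\<^sup>2)
      \<le> 2 * (LINT x|M. (norm (f n x - g x))\<^sup>2) + 2 * (LINT x|M. (norm (g x))\<^sup>2)"
      by (rule integral_norm_sq_add_le) (use idiff int in auto)
    then show ?thesis using C[of n] by (simp add: G_def)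
  qed
  define q where "q n x = norm (f n x) + norm (g x)" for n x
  have qi: "integrable M (\<lambda>x. (q n x)\<^sup>2)" for n
    using integrable_norm_sq_add[of "\<lambda>x. norm (f n x)" M "\<lambda>x. norm (g x)"] int by (simp add: q_def)
  have qb: "(LINT x|M. (q n x)\<^sup>2) \<le> 2 * (2 * C + 2 * G) + 2 * G" for n
    using integral_norm_sq_add_le[of "\<lambda>x. norm (f n x)" M "\<lambda>x. norm (g x)"] int fb[of n]
    by (simp add: q_def G_def)
  have "(\<lambda>n. LINT x|M. norm (f n x - g x) * q n x) \<longlonglongrightarrow> 0"
    by (rule integral_mult_tendsto_0[OF _ _ _ qi _ qb]) (use idiff lim in \<open>auto simp: q_def\<close>)
  then have "(\<lambda>n. (LINT x|M. \<Phi> (f n x)) - (LINT x|M. \<Phi> (g x))) \<longlonglongrightarrow> 0"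
  proof (rule tendsto_0_le[where K = B], intro always_eventually allI)
    fix n
    have iq: "integrable M (\<lambda>x. norm (f n x - g x) * q n x)"
      by (rule integrable_mult_of_squares) (use idiff qi in \<open>auto simp: q_def\<close>)
    have nn: "0 \<le> (LINT x|M. norm (f n x - g x) * q n x)" by (auto simp: q_def intro!: integral_nonneg)
    have "norm ((LINT x|M. \<Phi> (f n x)) - (LINT x|M. \<Phi> (g x))) = norm (LINT x|M. \<Phi> (f n x) - \<Phi> (g x))"
      using ig i[OF meas(1) int(1)] by simp
    also have "\<dots> \<le> (LINT x|M. norm (\<Phi> (f n x) - \<Phi> (g x)))" by (rule integral_norm_bound)
    also have "\<dots> \<le> (LINT x|M. B * (norm (f n x - g x) * q n x))"
      using ig i[OF meas(1) int(1)] iq growth by (intro integral_mono) (auto simp: q_def)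
    finally show "norm ((LINT x|M. \<Phi> (f n x)) - (LINT x|M. \<Phi> (g x)))
        \<le> norm (LINT x|M. norm (f n x - g x) * q n x) * B"
      using nn iq by (simp add: mult.commute)
  qed
  then show "(\<lambda>n. LINT x|M. \<Phi> (f n x)) \<longlonglongrightarrow> (LINT x|M. \<Phi> (g x))" by (simp add: LIM_zero_iff)
qed

text \<open>Dominated convergence for the difference quotients. Only differentiability at 0 is asked
  of the integrand, which is all that the square of \<open>F\<close> offers along a line that may
  meet the origin.\<close>

lemma has_real_derivative_integral:
  fixes k :: "real \<Rightarrow> 'a \<Rightarrow> real"
  assumes meas [measurable]: "\<And>t. k t \<in> borel_measurable M"
    and k0: "integrable M (k 0)"
    and deriv: "\<And>x. ((\<lambda>t. k t x) has_real_derivative k' x) (at 0)"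
    and \<delta>: "0 < \<delta>" and bound: "\<And>t x. \<bar>t\<bar> < \<delta> \<Longrightarrow> \<bar>k t x - k 0 x\<bar> \<le> \<bar>t\<bar> * w x"
    and w: "integrable M w"
  shows "((\<lambda>t. LINT x|M. k t x) has_real_derivative (LINT x|M. k' x)) (at 0)"
proof -
  have kt: "integrable M (k t)" if "\<bar>t\<bar> < \<delta>" for t
  proof -
    have "integrable M (\<lambda>x. k t x - k 0 x)"
    proof (rule Bochner_Integration.integrable_bound)
      show "integrable M (\<lambda>x. \<bar>t\<bar> * w x)" using w by auto
      show "AE x in M. norm (k t x - k 0 x) \<le> norm (\<bar>t\<bar> * w x)"
        using bound[OF that] by (intro AE_I2) (metis abs_ge_self order_trans real_norm_def)
    qed measurable
    from Bochner_Integration.integrable_add[OF this k0] show ?thesis by simp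
  qed
  have "((\<lambda>t. ((LINT x|M. k t x) - (LINT x|M. k 0 x)) / t) \<longlongrightarrow> (LINT x|M. k' x)) (at 0)"
    unfolding LIMSEQ_SEQ_conv[symmetric]
  proof (intro allI impI, elim conjE)
    fix S :: "nat \<Rightarrow> real" assume S: "\<forall>n. S n \<noteq> 0" "S \<longlonglongrightarrow> 0"
    have "\<forall>\<^sub>F n in sequentially. \<bar>S n\<bar> < \<delta>"
      using order_tendstoD(2)[OF tendsto_rabs[OF S(2)], of \<delta>] \<delta> by simp
    then obtain N where N: "\<And>n. n \<ge> N \<Longrightarrow> \<bar>S n\<bar> < \<delta>" by (auto simp: eventually_sequentially)
    \<comment> \<open>The shift by \<open>N\<close> discards the terms for which the domination by
      \<open>w\<close> is not yet available.\<close>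
    define s where "s n x = (k (S (n + N)) x - k 0 x) / S (n + N)" for n x
    have [measurable]: "s n \<in> borel_measurable M" for n unfolding s_def by measurable
    have lim: "(\<lambda>n. s n x) \<longlonglongrightarrow> k' x" for x
    proof -
      have "((\<lambda>t. (k t x - k 0 x) / t) \<longlongrightarrow> k' x) (at 0)" using deriv[of x] by (simp add: DERIV_def)
      then have "(\<lambda>n. (k (S n) x - k 0 x) / S n) \<longlonglongrightarrow> k' x"
        unfolding LIMSEQ_SEQ_conv[symmetric] using S by auto
      then show ?thesis unfolding s_def by (rule LIMSEQ_ignore_initial_segment)
    qed
    have [measurable]: "k' \<in> borel_measurable M"
      by (rule borel_measurable_LIMSEQ_real[where u = s]) (auto intro: lim)
    have sb: "norm (s n x) \<le> w x" for n x
      using bound[OF N[of "n + N"], of x] S(1) by (simp add: s_def abs_divide divide_le_eq mult.commute)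
    have "(\<lambda>n. LINT x|M. s n x) \<longlonglongrightarrow> (LINT x|M. k' x)"
      by (rule integral_dominated_convergence[where w = w]) (use sb in \<open>auto intro!: lim w simp: AE_I2\<close>)
    moreover have "(LINT x|M. s n x) = ((LINT x|M. k (S (n + N)) x) - (LINT x|M. k 0 x)) / S (n + N)" for n
      unfolding s_def using kt[OF N[of "n + N"]] k0 by simp
    ultimately have "(\<lambda>n. ((LINT x|M. k (S (n + N)) x) - (LINT x|M. k 0 x)) / S (n + N)) \<longlonglongrightarrow> (LINT x|M. k' x)"
      by simp
    then show "(\<lambda>n. ((LINT x|M. k (S n) x) - (LINT x|M. k 0 x)) / S n) \<longlonglongrightarrow> (LINT x|M. k' x)"
      by (rule LIMSEQ_offset)
  qed
  then show ?thesis by (simp add: DERIV_def)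
qed

section \<open>Limits of test functions\<close>

text \<open>With \<open>p = exp (a / 2)\<close> and \<open>q = exp (b / 2)\<close> the gap is
  \<open>(p - q)\<^sup>2 / 2\<close>, and \<open>1 + x \<le> exp x\<close> gives
  \<open>p - q \<le> p * (a - b) / 2\<close> for \<open>b \<le> a\<close>. It measures how far the
  term \<open>- lam * exp u\<close> can spoil convexity.\<close>

lemma exp_midpoint_gap:
  fixes a b :: real
  shows "(exp a + exp b) / 2 - exp ((a + b) / 2) \<le> (a - b)\<^sup>2 * (exp a + exp b) / 8"
proof -
  have *: "(exp a + exp b) / 2 - exp ((a + b) / 2) \<le> (a - b)\<^sup>2 * (exp a + exp b) / 8"
    if "b \<le> a" for a b :: real
  proof -
    define p q where "p = exp (a / 2)" and "q = exp (b / 2)"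
    have pq: "exp a = p\<^sup>2" "exp b = q\<^sup>2" "exp ((a + b) / 2) = p * q" "q \<le> p" "0 \<le> p"
      using that by (auto simp: p_def q_def exp_add[symmetric] power2_eq_square field_simps)
    have "q = p * exp ((b - a) / 2)" by (simp add: p_def q_def exp_add[symmetric] field_simps)
    moreover have "p * (1 + (b - a) / 2) \<le> p * exp ((b - a) / 2)"
      by (intro mult_left_mono exp_ge_add_one_self pq)
    ultimately have "p - q \<le> p * ((a - b) / 2)" by (simp add: field_simps)
    then have "(p - q)\<^sup>2 \<le> (p * ((a - b) / 2))\<^sup>2" using pq by (intro power_mono) auto
    then have le: "(p - q)\<^sup>2 \<le> (a - b)\<^sup>2 * p\<^sup>2 / 4"
      by (simp add: power_mult_distrib power_divide mult.commute)
    have "(p\<^sup>2 + q\<^sup>2) / 2 - p * q = (p - q)\<^sup>2 / 2" by (simp add: power2_eq_square field_simps)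
    also have "\<dots> \<le> ((a - b)\<^sup>2 * p\<^sup>2 / 4) / 2" by (intro divide_right_mono le) simp
    also have "\<dots> \<le> (a - b)\<^sup>2 * (p\<^sup>2 + q\<^sup>2) / 8" by (simp add: distrib_left)
    finally show ?thesis unfolding pq(1-3) .
  qed
  show ?thesis
  proof (cases "b \<le> a")
    case False
    then show ?thesis using *[of a b] by (simp add: add.commute power2_commute)
  qed (rule *)
qed

lemma abs_exp_diff_le:
  fixes a b :: real
  shows "\<bar>exp a - exp b\<bar> \<le> \<bar>a - b\<bar> * (exp a + exp b)"
proof -
  have *: "\<bar>exp a - exp b\<bar> \<le> \<bar>a - b\<bar> * (exp a + exp b)" if "b \<le> a" for a b :: real
  proof -
    have "exp a * (1 + (b - a)) \<le> exp a * exp (b - a)"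
      by (intro mult_left_mono exp_ge_add_one_self) auto
    moreover have "exp a * exp (b - a) = exp b" by (simp add: exp_add[symmetric])
    ultimately have "exp a - exp b \<le> (a - b) * exp a" by (simp add: algebra_simps)
    also have "\<dots> \<le> (a - b) * (exp a + exp b)" using that by (intro mult_left_mono) auto
    finally show ?thesis using that by simp
  qed
  show ?thesis
  proof (cases "b \<le> a")
    case False
    then show ?thesis using *[of a b] by (simp add: abs_minus_commute add.commute)
  qed (rule *)
qed

lemma test_fun_zero: "test_fun \<Omega> (\<lambda>x. 0)"
  unfolding test_fun_def using bump_algebra_smooth2[OF bump_algebra.const] by simp

section \<open>Sobolev functions as limits of test functions\<close>

context plane_domain
begin

definition Dir :: "(real^2 \<Rightarrow> real) \<Rightarrow> real" where
  "Dir \<phi> = (LINT x|M. (norm (grad \<phi> x))\<^sup>2)"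

text \<open>\<open>W012_0\<close> with its approximating sequence made explicit, because the
  exponential estimates need a bound on \<open>Dir\<close> along that very sequence.\<close>

definition approx :: "(nat \<Rightarrow> real^2 \<Rightarrow> real) \<Rightarrow> (real^2 \<Rightarrow> real) \<Rightarrow> (real^2 \<Rightarrow> real^2) \<Rightarrow> bool" where
  "approx \<phi> u g \<longleftrightarrow> u \<in> borel_measurable M \<and> g \<in> borel_measurable M \<and>
     integrable M (\<lambda>x. (u x)\<^sup>2) \<and> integrable M (\<lambda>x. (norm (g x))\<^sup>2) \<and>
     (\<forall>n. test_fun \<Omega> (\<phi> n)) \<and>
     (\<lambda>n. LINT x|M. (\<phi> n x - u x)\<^sup>2) \<longlonglongrightarrow> 0 \<and>
     (\<lambda>n. LINT x|M. (norm (grad (\<phi> n) x - g x))\<^sup>2) \<longlonglongrightarrow> 0"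

lemma set_integral_eq:
  fixes f :: "real^2 \<Rightarrow> 'b::euclidean_space"
  shows "(LINT x:\<Omega>|lebesgue. f x) = (LINT x|M. f x)"
  unfolding set_lebesgue_integral_def by (rule integral_restrict_space[symmetric]) simp

lemma set_integrable_eq:
  fixes f :: "real^2 \<Rightarrow> 'b::euclidean_space"
  shows "set_integrable lebesgue \<Omega> f \<longleftrightarrow> integrable M f"
  unfolding set_integrable_def by (rule integrable_restrict_space[symmetric]) simp

lemma set_borel_measurable_eq:
  fixes f :: "real^2 \<Rightarrow> 'b::euclidean_space"
  shows "set_borel_measurable lebesgue \<Omega> f \<longleftrightarrow> f \<in> borel_measurable M"
  unfolding set_borel_measurable_def by (rule borel_measurable_restrict_space_iff[symmetric]) simp

lemma W012_0_iff: "W012_0 \<Omega> u g \<longleftrightarrow> (\<exists>\<phi>. approx \<phi> u g)"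
  unfolding W012_0_def approx_def set_integral_eq set_integrable_eq set_borel_measurable_eq by blast

lemma energy_eq: "energy \<Omega> F lam u g = (LINT x|M. (F (g x))\<^sup>2) / 2 - lam * (LINT x|M. exp (u x))"
  unfolding energy_def set_integral_eq by simp

lemma test_measurable [measurable]:
  assumes "test_fun \<Omega> \<phi>"
  shows "\<phi> \<in> borel_measurable M" "grad \<phi> \<in> borel_measurable M"
  using test_continuous[OF assms] by (auto intro: continuous_measurable)

lemma test_integrable_sq:
  assumes "test_fun \<Omega> \<phi>"
  shows "integrable M (\<lambda>x. (\<phi> x)\<^sup>2)"
  using test_integrable_power[OF assms, of 1] by simp

lemma approxD:
  assumes "approx \<phi> u g"
  shows "u \<in> borel_measurable M" "g \<in> borel_measurable M"
    "integrable M (\<lambda>x. (u x)\<^sup>2)" "integrable M (\<lambda>x. (norm (g x))\<^sup>2)" "\<And>n. test_fun \<Omega> (\<phi> n)"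
    "(\<lambda>n. LINT x|M. (\<phi> n x - u x)\<^sup>2) \<longlonglongrightarrow> 0"
    "(\<lambda>n. LINT x|M. (norm (grad (\<phi> n) x - g x))\<^sup>2) \<longlonglongrightarrow> 0"
    "\<And>n. integrable M (\<lambda>x. (\<phi> n x - u x)\<^sup>2)" "\<And>n. integrable M (\<lambda>x. (norm (grad (\<phi> n) x - g x))\<^sup>2)"
proof -
  show a: "u \<in> borel_measurable M" "g \<in> borel_measurable M"
    "integrable M (\<lambda>x. (u x)\<^sup>2)" "integrable M (\<lambda>x. (norm (g x))\<^sup>2)" "\<And>n. test_fun \<Omega> (\<phi> n)"
    "(\<lambda>n. LINT x|M. (\<phi> n x - u x)\<^sup>2) \<longlonglongrightarrow> 0"
    "(\<lambda>n. LINT x|M. (norm (grad (\<phi> n) x - g x))\<^sup>2) \<longlonglongrightarrow> 0"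
    using assms unfolding approx_def by auto
  show "integrable M (\<lambda>x. (\<phi> n x - u x)\<^sup>2)" for n
    using integrable_norm_sq_diff[of "\<phi> n" M u] a test_measurable[OF a(5)[of n]] test_integrable_sq[OF a(5)[of n]]
    by simp
  show "integrable M (\<lambda>x. (norm (grad (\<phi> n) x - g x))\<^sup>2)" for n
    using integrable_norm_sq_diff[of "grad (\<phi> n)" M g] a test_measurable[OF a(5)[of n]]
      test_integrable_grad_sq[OF a(5)[of n]] by simp
qed

text \<open>Turns a bound on \<open>Dir\<close> that holds eventually into one that holds for all
  indices.\<close>

lemma approx_offset:
  assumes "approx \<phi> u g"
  shows "approx (\<lambda>n. \<phi> (n + N)) u g"
  using approxD(1-5)[OF assms] LIMSEQ_ignore_initial_segment[OF approxD(6)[OF assms], of N]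
    LIMSEQ_ignore_initial_segment[OF approxD(7)[OF assms], of N]
  unfolding approx_def by simp

lemma L2_tendsto_add_scaled:
  fixes f f' :: "nat \<Rightarrow> real^2 \<Rightarrow> 'b::euclidean_space"
  assumes [measurable]: "\<And>n. f n \<in> borel_measurable M" "\<And>n. f' n \<in> borel_measurable M"
    and int: "\<And>n. integrable M (\<lambda>x. (norm (f n x))\<^sup>2)" "\<And>n. integrable M (\<lambda>x. (norm (f' n x))\<^sup>2)"
    and lim: "(\<lambda>n. LINT x|M. (norm (f n x))\<^sup>2) \<longlonglongrightarrow> 0" "(\<lambda>n. LINT x|M. (norm (f' n x))\<^sup>2) \<longlonglongrightarrow> 0"
  shows "(\<lambda>n. LINT x|M. (norm (f n x + t *\<^sub>R f' n x))\<^sup>2) \<longlonglongrightarrow> 0"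
proof (rule tendsto_sandwich[OF _ _ tendsto_const])
  have "(\<lambda>n. 2 * (LINT x|M. (norm (f n x))\<^sup>2) + 2 * (t\<^sup>2 * (LINT x|M. (norm (f' n x))\<^sup>2))) \<longlonglongrightarrow> 2 * 0 + 2 * (t\<^sup>2 * 0)"
    by (intro tendsto_intros lim)
  then show "(\<lambda>n. 2 * (LINT x|M. (norm (f n x))\<^sup>2) + 2 * (t\<^sup>2 * (LINT x|M. (norm (f' n x))\<^sup>2))) \<longlonglongrightarrow> 0" by simp
  show "\<forall>\<^sub>F n in sequentially. (LINT x|M. (norm (f n x + t *\<^sub>R f' n x))\<^sup>2)
      \<le> 2 * (LINT x|M. (norm (f n x))\<^sup>2) + 2 * (t\<^sup>2 * (LINT x|M. (norm (f' n x))\<^sup>2))"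
  proof (intro always_eventually allI)
    fix n
    show "(LINT x|M. (norm (f n x + t *\<^sub>R f' n x))\<^sup>2)
      \<le> 2 * (LINT x|M. (norm (f n x))\<^sup>2) + 2 * (t\<^sup>2 * (LINT x|M. (norm (f' n x))\<^sup>2))"
      using integral_norm_sq_add_le[of "f n" M "\<lambda>x. t *\<^sub>R f' n x"] int
      by (simp add: power_mult_distrib)
  qed
qed simp

lemma approx_add_scaled:
  assumes A: "approx \<phi> u g" and B: "approx \<psi> v h"
  shows "approx (\<lambda>n x. \<phi> n x + t * \<psi> n x) (\<lambda>x. u x + t * v x) (\<lambda>x. g x + t *\<^sub>R h x)"
proof -
  note a = approxD[OF A] and b = approxD[OF B]
  note [measurable] = a(1,2) b(1,2)
  note [measurable] = test_measurable[OF a(5)] test_measurable[OF b(5)]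
  have sm: "smooth2 (\<phi> n)" "smooth2 (\<psi> n)" for n using a(5) b(5) by (auto simp: test_fun_def)
  have gr: "grad (\<lambda>x. \<phi> n x + t * \<psi> n x) x = grad (\<phi> n) x + t *\<^sub>R grad (\<psi> n) x" for n x
    using grad_lincomb[OF sm[of n], of 1 t x] by simp
  have te: "test_fun \<Omega> (\<lambda>x. \<phi> n x + t * \<psi> n x)" for n
    using test_fun_lincomb[OF a(5)[of n] b(5)[of n], of 1 t] by simp
  have i1: "integrable M (\<lambda>x. (u x + t * v x)\<^sup>2)"
    using integrable_norm_sq_add[of u M "\<lambda>x. t * v x"] a(3) b(3) by (simp add: power_mult_distrib)
  have i2: "integrable M (\<lambda>x. (norm (g x + t *\<^sub>R h x))\<^sup>2)"
    using integrable_norm_sq_add[of g M "\<lambda>x. t *\<^sub>R h x"] a(4) b(4) by (simp add: power_mult_distrib)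
  have "(\<lambda>n. LINT x|M. (norm ((\<phi> n x - u x) + t *\<^sub>R (\<psi> n x - v x)))\<^sup>2) \<longlonglongrightarrow> 0"
    by (rule L2_tendsto_add_scaled) (use a b in auto)
  moreover have "(\<phi> n x - u x) + t * (\<psi> n x - v x) = \<phi> n x + t * \<psi> n x - (u x + t * v x)" for n x
    by (simp add: algebra_simps)
  ultimately have l1: "(\<lambda>n. LINT x|M. (\<phi> n x + t * \<psi> n x - (u x + t * v x))\<^sup>2) \<longlonglongrightarrow> 0" by simp
  have "(\<lambda>n. LINT x|M. (norm ((grad (\<phi> n) x - g x) + t *\<^sub>R (grad (\<psi> n) x - h x)))\<^sup>2) \<longlonglongrightarrow> 0"
    by (rule L2_tendsto_add_scaled) (use a b in auto)
  moreover have "(grad (\<phi> n) x - g x) + t *\<^sub>R (grad (\<psi> n) x - h x)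
      = grad (\<phi> n) x + t *\<^sub>R grad (\<psi> n) x - (g x + t *\<^sub>R h x)" for n x
    by (simp add: algebra_simps)
  ultimately have l2: "(\<lambda>n. LINT x|M. (norm (grad (\<phi> n) x + t *\<^sub>R grad (\<psi> n) x - (g x + t *\<^sub>R h x)))\<^sup>2) \<longlonglongrightarrow> 0"
    by simp
  show ?thesis unfolding approx_def gr using te i1 i2 l1 l2 by simp
qed

lemma approx_quadratic_growth:
  assumes A: "approx \<phi> u g"
    and "continuous_on UNIV \<Phi>" "\<Phi> 0 = 0"
    and "\<And>x y. \<bar>\<Phi> x - \<Phi> y\<bar> \<le> B * (norm (x - y) * (norm x + norm y))"
  shows "integrable M (\<lambda>x. \<Phi> (g x))" "(\<lambda>n. LINT x|M. \<Phi> (grad (\<phi> n) x)) \<longlonglongrightarrow> (LINT x|M. \<Phi> (g x))"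
  by (rule integral_quadratic_growth[where f = "\<lambda>n. grad (\<phi> n)"];
      use assms approxD[OF A] test_measurable test_integrable_grad_sq in blast)+

lemma approx_Dir_tendsto:
  assumes "approx \<phi> u g"
  shows "(\<lambda>n. Dir (\<phi> n)) \<longlonglongrightarrow> (LINT x|M. (norm (g x))\<^sup>2)"
  unfolding Dir_def
proof (rule approx_quadratic_growth(2)[OF assms, where \<Phi> = "\<lambda>x. (norm x)\<^sup>2" and B = 1])
  show "continuous_on UNIV (\<lambda>x::real^2. (norm x)\<^sup>2)" by (intro continuous_intros)
  fix x y :: "real^2"
  have "\<bar>(norm x)\<^sup>2 - (norm y)\<^sup>2\<bar> = \<bar>norm x - norm y\<bar> * (norm x + norm y)"
    by (simp add: power2_eq_square square_diff_square_factored abs_mult)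
  also have "\<dots> \<le> norm (x - y) * (norm x + norm y)"
    by (intro mult_right_mono norm_triangle_ineq3) auto
  finally show "\<bar>(norm x)\<^sup>2 - (norm y)\<^sup>2\<bar> \<le> 1 * (norm (x - y) * (norm x + norm y))" by simp
qed simp

text \<open>The test function estimate passes to \<open>u\<close> by Fatou along an almost
  everywhere convergent subsequence.\<close>

lemma approx_exp_moment:
  assumes A: "approx \<phi> u g" and s: "\<And>n. s\<^sup>2 * Dir (\<phi> n) \<le> 1 / 2"
  shows "integrable M (\<lambda>x. exp (s * \<bar>u x\<bar>))" "(LINT x|M. exp (s * \<bar>u x\<bar>)) \<le> 4 * vol"
proof -
  note a = approxD[OF A]
  note [measurable] = a(1)
  obtain r :: "nat \<Rightarrow> nat" where r: "strict_mono r" "AE x in M. (\<lambda>n. \<phi> (r n) x) \<longlonglongrightarrow> u x"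
    by (rule AE_subseq_of_L2[OF a(8) a(6)])
  have 1: "integrable M (\<lambda>x. exp (s * \<bar>\<phi> (r k) x\<bar>))" for k by (rule test_integrable_exp[OF a(5)])
  have 2: "\<forall>\<^sub>F k in sequentially. (LINT x|M. exp (s * \<bar>\<phi> (r k) x\<bar>)) \<le> 4 * vol"
    using exp_moment_bound[OF a(5)] s by (auto simp: Dir_def)
  have 3: "AE x in M. (\<lambda>k. exp (s * \<bar>\<phi> (r k) x\<bar>)) \<longlonglongrightarrow> exp (s * \<bar>u x\<bar>)"
    using r(2) by eventually_elim (intro tendsto_intros)
  show "integrable M (\<lambda>x. exp (s * \<bar>u x\<bar>))" "(LINT x|M. exp (s * \<bar>u x\<bar>)) \<le> 4 * vol"
    by (rule integral_Fatou[OF 1 _ 2 3]; simp)+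
qed

text \<open>Variations need not lie in the small ball, so the exponent \<open>s\<close> has to
  depend on the function. With \<open>C\<close> bounding \<open>Dir\<close> along the sequence,
  \<open>s\<^sup>2 = 1 / (2 * C)\<close> is admissible.\<close>

lemma approx_exp_integrable:
  assumes A: "approx \<phi> u g"
  obtains s where "0 < s" "integrable M (\<lambda>x. exp (s * \<bar>u x\<bar>))"
proof -
  obtain C where C: "0 < C" "\<And>n. Dir (\<phi> n) \<le> C"
    using convergent_imp_Bseq[OF convergentI[OF approx_Dir_tendsto[OF A]]] unfolding Bseq_def
    by (auto dest: abs_le_D1)
  have "(sqrt (1 / (2 * C)))\<^sup>2 * Dir (\<phi> n) \<le> 1 / 2" for n
    using C(1) C(2)[of n] by (simp add: field_simps)
  from approx_exp_moment(1)[OF A this] C(1) show ?thesis by (intro that) auto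
qed

lemma approx_exp_sq:
  assumes A: "approx \<phi> u g" and D: "\<And>n. Dir (\<phi> n) \<le> 1 / 32"
  shows "integrable M (\<lambda>x. exp (2 * \<bar>u x\<bar>))" "(LINT x|M. exp (2 * \<bar>u x\<bar>)) \<le> 4 * vol"
    "integrable M (\<lambda>x. exp (u x))" "integrable M (\<lambda>x. (exp (u x))\<^sup>2)" "(LINT x|M. (exp (u x))\<^sup>2) \<le> 4 * vol"
    "(LINT x|M. exp (u x)) \<le> 4 * vol"
proof -
  note [measurable] = approxD(1)[OF A]
  have s: "2\<^sup>2 * Dir (\<phi> n) \<le> 1 / 2" for n using D[of n] by simp
  show i: "integrable M (\<lambda>x. exp (2 * \<bar>u x\<bar>))" and le: "(LINT x|M. exp (2 * \<bar>u x\<bar>)) \<le> 4 * vol"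
    using approx_exp_moment[OF A s] by auto
  show i1: "integrable M (\<lambda>x. exp (u x))"
    by (rule Bochner_Integration.integrable_bound[OF i]) auto
  have sq: "(exp (u x))\<^sup>2 = exp (2 * u x)" for x by (simp add: exp_double)
  show i2: "integrable M (\<lambda>x. (exp (u x))\<^sup>2)" unfolding sq
    by (rule Bochner_Integration.integrable_bound[OF i]) auto
  have "(LINT x|M. (exp (u x))\<^sup>2) \<le> (LINT x|M. exp (2 * \<bar>u x\<bar>))"
    using i2 i by (intro integral_mono) (auto simp: sq)
  with le show "(LINT x|M. (exp (u x))\<^sup>2) \<le> 4 * vol" by simp
  have "(LINT x|M. exp (u x)) \<le> (LINT x|M. exp (2 * \<bar>u x\<bar>))"
    using i1 i by (intro integral_mono) auto
  with le show "(LINT x|M. exp (u x)) \<le> 4 * vol" by simp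
qed

lemma approx_const:
  assumes "test_fun \<Omega> \<phi>"
  shows "approx (\<lambda>n. \<phi>) \<phi> (grad \<phi>)"
  unfolding approx_def using test_measurable[OF assms] test_integrable_sq[OF assms]
    test_integrable_grad_sq[OF assms] assms by simp

text \<open>By \<open>abs_exp_diff_le\<close> the difference is a product of
  \<open>\<bar>\<phi> n x - u x\<bar>\<close>, small in L2, and a sum of exponentials, bounded in L2
  by the radius of the ball.\<close>

lemma approx_exp_tendsto:
  assumes A: "approx \<phi> u g" and D: "\<And>n. Dir (\<phi> n) \<le> 1 / 32"
  shows "(\<lambda>n. LINT x|M. exp (\<phi> n x)) \<longlonglongrightarrow> (LINT x|M. exp (u x))"
proof -
  note a = approxD[OF A]
  note [measurable] = a(1) test_measurable[OF a(5)]
  note eu = approx_exp_sq[OF A D]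
  note ep = approx_exp_sq[OF approx_const[OF a(5)] D]
  define q where "q n x = exp (\<phi> n x) + exp (u x)" for n x
  have qm [measurable]: "q n \<in> borel_measurable M" for n unfolding q_def by measurable
  have qi: "integrable M (\<lambda>x. (q n x)\<^sup>2)" for n
    using integrable_norm_sq_add[of "\<lambda>x. exp (\<phi> n x)" M "\<lambda>x. exp (u x)"] eu ep(4)[of n] by (simp add: q_def)
  have qb: "(LINT x|M. (q n x)\<^sup>2) \<le> 16 * vol" for n
    using integral_norm_sq_add_le[of "\<lambda>x. exp (\<phi> n x)" M "\<lambda>x. exp (u x)"] eu(4,5) ep(4,5)[of n]
    by (simp add: q_def)
  have di: "integrable M (\<lambda>x. \<bar>\<phi> n x - u x\<bar>\<^sup>2)" for n using a(8) by simp
  have iq: "integrable M (\<lambda>x. \<bar>\<phi> n x - u x\<bar> * q n x)" for n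
    by (rule integrable_mult_of_squares[OF _ _ di qi]) auto
  have "(\<lambda>n. LINT x|M. \<bar>\<phi> n x - u x\<bar> * q n x) \<longlonglongrightarrow> 0"
    by (rule integral_mult_tendsto_0[OF _ _ di qi _ qb]) (use a(6) in auto)
  then have "(\<lambda>n. (LINT x|M. exp (\<phi> n x)) - (LINT x|M. exp (u x))) \<longlonglongrightarrow> 0"
  proof (rule tendsto_0_le[where K = 1], intro always_eventually allI)
    fix n
    have "norm ((LINT x|M. exp (\<phi> n x)) - (LINT x|M. exp (u x))) = norm (LINT x|M. exp (\<phi> n x) - exp (u x))"
      using eu(3) ep(3)[of n] by simp
    also have "\<dots> \<le> (LINT x|M. norm (exp (\<phi> n x) - exp (u x)))" by (rule integral_norm_bound)
    also have "\<dots> \<le> (LINT x|M. \<bar>\<phi> n x - u x\<bar> * q n x)"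
      using eu(3) ep(3)[of n] iq[of n] abs_exp_diff_le by (intro integral_mono) (auto simp: q_def)
    finally show "norm ((LINT x|M. exp (\<phi> n x)) - (LINT x|M. exp (u x)))
        \<le> norm (LINT x|M. \<bar>\<phi> n x - u x\<bar> * q n x) * 1" by simp
  qed
  then show ?thesis by (simp add: LIM_zero_iff)
qed

text \<open>Cauchy-Schwarz between the fourth moment of \<open>w\<close>, at most
  \<open>4 * (Dir w)\<^sup>2 * vol\<close>, and the square integral of \<open>exp \<phi>\<close>, at
  most \<open>4 * vol\<close>. This is the bound for the second variation of the exponential
  term.\<close>

lemma weighted_sq_bound:
  assumes w: "test_fun \<Omega> w" and \<phi>: "test_fun \<Omega> \<phi>" and D: "Dir \<phi> \<le> 1 / 32"
  shows "integrable M (\<lambda>x. (w x)\<^sup>2 * exp (\<phi> x))" "(LINT x|M. (w x)\<^sup>2 * exp (\<phi> x)) \<le> 4 * vol * Dir w"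
proof -
  note [measurable] = test_measurable[OF w] test_measurable[OF \<phi>]
  note e = approx_exp_sq[OF approx_const[OF \<phi>] D]
  have w4: "integrable M (\<lambda>x. ((w x)\<^sup>2)\<^sup>2)" using test_integrable_power[OF w, of 2] by simp
  have D0: "0 \<le> Dir w" by (simp add: Dir_def)
  show "integrable M (\<lambda>x. (w x)\<^sup>2 * exp (\<phi> x))"
    by (rule integrable_mult_of_squares[OF _ _ w4 e(4)]) auto
  have "(LINT x|M. (w x)\<^sup>2 * exp (\<phi> x))\<^sup>2 \<le> (LINT x|M. ((w x)\<^sup>2)\<^sup>2) * (LINT x|M. (exp (\<phi> x))\<^sup>2)"
    by (rule integral_Cauchy_Schwarz[OF _ _ w4 e(4)]) auto
  also have "\<dots> \<le> (4 * (Dir w)\<^sup>2 * vol) * (4 * vol)"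
    using moment_bound[OF w, of 2] e(5)
    by (intro mult_mono) (auto simp: Dir_def power_mult_distrib fact_numeral)
  also have "\<dots> = (4 * vol * Dir w)\<^sup>2" by (simp add: power2_eq_square)
  finally show "(LINT x|M. (w x)\<^sup>2 * exp (\<phi> x)) \<le> 4 * vol * Dir w"
    using D0 by (auto dest!: power2_le_imp_le intro!: mult_nonneg_nonneg)
qed

end

section \<open>Minimization of the energy\<close>

locale finsler_domain = plane_domain +
  fixes F :: "real^2 \<Rightarrow> real" and a b \<kappa> :: real
  assumes admissible: "admissible_F F"
    and a_pos: "0 < a" and b_nonneg: "0 \<le> b" and \<kappa>_pos: "0 < \<kappa>"
    and lower: "\<And>x. a * norm x \<le> F x" and upper: "\<And>x. F x \<le> b * norm x"
    and midpoint: "\<And>x y. (F ((1/2) *\<^sub>R (x + y)))\<^sup>2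
        \<le> (F x)\<^sup>2 / 2 + (F y)\<^sup>2 / 2 - \<kappa> * (norm (x - y))\<^sup>2"
begin

lemma F_zero: "F 0 = 0"
  using lower[of 0] upper[of 0] by simp

lemma F_sq_continuous: "continuous_on UNIV (\<lambda>x. (F x)\<^sup>2)"
  by (intro continuous_intros admissible_F_continuous admissible)

lemma F_sq_growth: "\<bar>(F x)\<^sup>2 - (F y)\<^sup>2\<bar> \<le> b\<^sup>2 * (norm (x - y) * (norm x + norm y))"
  by (rule admissible_F_sq_diff_le[OF admissible upper b_nonneg])

lemma approx_F_integrable: "approx \<phi> u g \<Longrightarrow> integrable M (\<lambda>x. (F (g x))\<^sup>2)"
  by (rule approx_quadratic_growth(1)[where \<Phi> = "\<lambda>x. (F x)\<^sup>2", OF _ F_sq_continuous _ F_sq_growth])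
     (auto simp: F_zero)

lemma approx_F_tendsto:
  "approx \<phi> u g \<Longrightarrow> (\<lambda>n. LINT x|M. (F (grad (\<phi> n) x))\<^sup>2) \<longlonglongrightarrow> (LINT x|M. (F (g x))\<^sup>2)"
  by (rule approx_quadratic_growth(2)[where \<Phi> = "\<lambda>x. (F x)\<^sup>2", OF _ F_sq_continuous _ F_sq_growth])
     (auto simp: F_zero)

definition J :: "real \<Rightarrow> (real^2 \<Rightarrow> real) \<Rightarrow> real" where
  "J lam \<phi> = energy \<Omega> F lam \<phi> (grad \<phi>)"

lemma energy_tendsto:
  assumes A: "approx \<phi> u g" and D: "\<And>n. Dir (\<phi> n) \<le> 1 / 32"
  shows "(\<lambda>n. J lam (\<phi> n)) \<longlonglongrightarrow> energy \<Omega> F lam u g"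
  unfolding J_def energy_eq
  by (intro tendsto_intros approx_F_tendsto[OF A] approx_exp_tendsto[OF A D]) simp

text \<open>Halved as in the energy, the gradient term gains \<open>\<kappa> / 2 * Dir w\<close>.
  The exponential term loses at most \<open>lam * vol * Dir w\<close>, where \<open>vol\<close> is
  \<open>(4 * vol + 4 * vol) / 8\<close>; by the smallness of \<open>lam\<close> this is at most
  half of the gain.\<close>

lemma J_midpoint:
  assumes t: "test_fun \<Omega> \<phi>" "test_fun \<Omega> \<psi>" and D: "Dir \<phi> \<le> 1 / 32" "Dir \<psi> \<le> 1 / 32"
    and lam: "0 \<le> lam" "lam * vol \<le> \<kappa> / 4"
  defines "m \<equiv> \<lambda>x. (1/2) * \<phi> x + (1/2) * \<psi> x" and "w \<equiv> \<lambda>x. \<phi> x - \<psi> x"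
  shows "test_fun \<Omega> m" "Dir m \<le> 1 / 32" "test_fun \<Omega> w"
    and "Dir w = (LINT x|M. (norm (grad \<phi> x - grad \<psi> x))\<^sup>2)"
    and "J lam m \<le> J lam \<phi> / 2 + J lam \<psi> / 2 - \<kappa> / 4 * Dir w"
proof -
  note [measurable] = test_measurable[OF t(1)] test_measurable[OF t(2)]
  have sm: "smooth2 \<phi>" "smooth2 \<psi>" using t by (auto simp: test_fun_def)
  show tm: "test_fun \<Omega> m" unfolding m_def by (rule test_fun_lincomb[OF t])
  show tw: "test_fun \<Omega> w" unfolding w_def using test_fun_lincomb[OF t, of 1 "-1"] by simp
  have gm: "grad m x = (1/2) *\<^sub>R (grad \<phi> x + grad \<psi> x)" for x
    unfolding m_def using grad_lincomb[OF sm, of "1/2" "1/2" x] by (simp add: scaleR_add_right)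
  have gw: "grad w x = grad \<phi> x - grad \<psi> x" for x
    unfolding w_def using grad_lincomb[OF sm, of 1 "-1" x] by simp
  show Dw: "Dir w = (LINT x|M. (norm (grad \<phi> x - grad \<psi> x))\<^sup>2)" by (simp add: Dir_def gw)
  note ig = test_integrable_grad_sq[OF t(1)] test_integrable_grad_sq[OF t(2)] test_integrable_grad_sq[OF tm]
    test_integrable_grad_sq[OF tw]
  have "Dir m \<le> (LINT x|M. (norm (grad \<phi> x))\<^sup>2 / 2 + (norm (grad \<psi> x))\<^sup>2 / 2)"
    unfolding Dir_def
  proof (intro integral_mono)
    show "(norm (grad m x))\<^sup>2 \<le> (norm (grad \<phi> x))\<^sup>2 / 2 + (norm (grad \<psi> x))\<^sup>2 / 2" for x
      using norm_add_sq_le[of "grad \<phi> x" "grad \<psi> x"] unfolding gm by (simp add: power_divide)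
  qed (use ig in auto)
  also have "\<dots> = Dir \<phi> / 2 + Dir \<psi> / 2" using ig by (simp add: Dir_def)
  finally show Dm: "Dir m \<le> 1 / 32" using D by simp
  have iF: "integrable M (\<lambda>x. (F (grad \<eta> x))\<^sup>2)" if "test_fun \<Omega> \<eta>" for \<eta>
    by (rule approx_F_integrable[OF approx_const[OF that]])
  have "(LINT x|M. (F (grad m x))\<^sup>2)
      \<le> (LINT x|M. (F (grad \<phi> x))\<^sup>2 / 2 + (F (grad \<psi> x))\<^sup>2 / 2 - \<kappa> * (norm (grad w x))\<^sup>2)"
  proof (intro integral_mono)
    show "(F (grad m x))\<^sup>2 \<le> (F (grad \<phi> x))\<^sup>2 / 2 + (F (grad \<psi> x))\<^sup>2 / 2 - \<kappa> * (norm (grad w x))\<^sup>2" for x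
      unfolding gm gw by (rule midpoint)
  qed (use iF t tm ig in auto)
  also have "\<dots> = (LINT x|M. (F (grad \<phi> x))\<^sup>2) / 2 + (LINT x|M. (F (grad \<psi> x))\<^sup>2) / 2 - \<kappa> * Dir w"
    using iF t ig by (simp add: Dir_def)
  finally have Fm: "(LINT x|M. (F (grad m x))\<^sup>2)
      \<le> (LINT x|M. (F (grad \<phi> x))\<^sup>2) / 2 + (LINT x|M. (F (grad \<psi> x))\<^sup>2) / 2 - \<kappa> * Dir w" .
  have ie: "integrable M (\<lambda>x. exp (\<eta> x))" if "test_fun \<Omega> \<eta>" for \<eta>
    using test_integrable_exp(2)[OF that, of 1] by simp
  note w1 = weighted_sq_bound[OF tw t(1) D(1)] and w2 = weighted_sq_bound[OF tw t(2) D(2)]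
  have "(LINT x|M. exp (\<phi> x) / 2 + exp (\<psi> x) / 2 - exp (m x))
      \<le> (LINT x|M. ((w x)\<^sup>2 * exp (\<phi> x) + (w x)\<^sup>2 * exp (\<psi> x)) / 8)"
  proof (intro integral_mono)
    fix x
    show "exp (\<phi> x) / 2 + exp (\<psi> x) / 2 - exp (m x) \<le> ((w x)\<^sup>2 * exp (\<phi> x) + (w x)\<^sup>2 * exp (\<psi> x)) / 8"
      using exp_midpoint_gap[of "\<phi> x" "\<psi> x"] by (simp add: m_def w_def add_divide_distrib distrib_left)
  qed (use ie t tm w1 w2 in auto)
  also have "\<dots> = ((LINT x|M. (w x)\<^sup>2 * exp (\<phi> x)) + (LINT x|M. (w x)\<^sup>2 * exp (\<psi> x))) / 8"
    using w1 w2 by simp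
  also have "\<dots> \<le> vol * Dir w" using w1(2) w2(2) by simp
  finally have "(LINT x|M. exp (\<phi> x)) / 2 + (LINT x|M. exp (\<psi> x)) / 2 - (LINT x|M. exp (m x)) \<le> vol * Dir w"
    using ie t tm by simp
  then have "lam * ((LINT x|M. exp (\<phi> x)) / 2 + (LINT x|M. exp (\<psi> x)) / 2 - (LINT x|M. exp (m x)))
      \<le> lam * (vol * Dir w)"
    using lam by (intro mult_left_mono)
  also have "\<dots> \<le> \<kappa> / 4 * Dir w"
    using mult_right_mono[OF lam(2), of "Dir w"] by (simp add: Dir_def mult.assoc)
  finally show "J lam m \<le> J lam \<phi> / 2 + J lam \<psi> / 2 - \<kappa> / 4 * Dir w"
    using Fm unfolding J_def energy_eq by (simp add: field_simps)
qed

lemma J_ge: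
  assumes "test_fun \<Omega> \<phi>" "Dir \<phi> \<le> 1 / 32" "0 \<le> lam"
  shows "- lam * (4 * vol) \<le> J lam \<phi>"
proof -
  have "0 \<le> (LINT x|M. (F (grad \<phi> x))\<^sup>2)" by simp
  moreover have "lam * (LINT x|M. exp (\<phi> x)) \<le> lam * (4 * vol)"
    using approx_exp_sq(6)[OF approx_const[OF assms(1)] assms(2)] assms(3) by (intro mult_left_mono)
  ultimately show ?thesis unfolding J_def energy_eq by linarith
qed

text \<open>The infimum is over test functions only. The limit need not be one, but its energy
  equals the infimum by continuity.\<close>

lemma minimizing_sequence:
  assumes lam: "0 < lam" "lam * vol \<le> \<kappa> / 4"
  obtains \<phi> u g c where "approx \<phi> u g" "\<And>n. Dir (\<phi> n) \<le> 1 / 32" "energy \<Omega> F lam u g = c"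
    "\<And>\<psi>. test_fun \<Omega> \<psi> \<Longrightarrow> Dir \<psi> \<le> 1 / 32 \<Longrightarrow> c \<le> J lam \<psi>"
proof -
  define K where "K = {\<phi>. test_fun \<Omega> \<phi> \<and> Dir \<phi> \<le> 1 / 32}"
  define c where "c = Inf (J lam ` K)"
  have grad0: "grad (\<lambda>x. 0) x = 0" for x :: "real^2"
    by (rule grad_eqI) (simp add: inner_zero_left[abs_def])
  have "(\<lambda>x. 0) \<in> K" by (auto simp: K_def test_fun_zero Dir_def grad0)
  then have ne: "J lam ` K \<noteq> {}" by blast
  have bdd: "bdd_below (J lam ` K)"
    using J_ge lam by (intro bdd_belowI[of _ "- lam * (4 * vol)"]) (auto simp: K_def)
  have c_le: "c \<le> J lam \<psi>" if "test_fun \<Omega> \<psi>" "Dir \<psi> \<le> 1 / 32" for \<psi>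
    unfolding c_def by (rule cInf_lower[OF _ bdd]) (use that in \<open>auto simp: K_def\<close>)
  have "\<exists>\<phi>. \<phi> \<in> K \<and> J lam \<phi> < c + 1 / real (Suc n)" for n
    using cInf_lessD[OF ne, of "c + 1 / real (Suc n)"] by (auto simp: c_def)
  then obtain \<phi> where \<phi>: "\<And>n. \<phi> n \<in> K" "\<And>n. J lam (\<phi> n) < c + 1 / real (Suc n)" by metis
  have t: "test_fun \<Omega> (\<phi> n)" and D: "Dir (\<phi> n) \<le> 1 / 32" for n using \<phi>(1)[of n] by (auto simp: K_def)
  \<comment> \<open>The midpoint is again a competitor, so its energy is at least \<open>c\<close>;
    the convexity gain therefore cannot exceed the average excess of the two energies over
    \<open>c\<close>.\<close>
  have gap: "\<kappa> / 4 * (LINT x|M. (norm (grad (\<phi> m) x - grad (\<phi> n) x))\<^sup>2)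
      \<le> (1 / real (Suc m) + 1 / real (Suc n)) / 2" for m n
  proof -
    note mid = J_midpoint[OF t[of m] t[of n] D[of m] D[of n] less_imp_le[OF lam(1)] lam(2)]
    have "J lam (\<phi> m) / 2 + J lam (\<phi> n) / 2 - \<kappa> / 4 * Dir (\<lambda>x. \<phi> m x - \<phi> n x) \<ge> c"
      using mid(5) c_le[OF mid(1,2)] by linarith
    then show ?thesis unfolding mid(4)[symmetric] using \<phi>(2)[of m] \<phi>(2)[of n] by argo
  qed
  have small: "\<exists>N. \<forall>m\<ge>N. \<forall>n\<ge>N. (LINT x|M. (norm (grad (\<phi> m) x - grad (\<phi> n) x))\<^sup>2) \<le> e" if e: "0 < e" for e
  proof -
    obtain N where N: "1 / real (Suc N) < \<kappa> / 4 * e"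
      by (rule nat_approx_posE[of "\<kappa> / 4 * e"]) (use e \<kappa>_pos in auto)
    have "(LINT x|M. (norm (grad (\<phi> m) x - grad (\<phi> n) x))\<^sup>2) \<le> e" if mn: "m \<ge> N" "n \<ge> N" for m n
    proof -
      have "1 / real (Suc m) \<le> 1 / real (Suc N)" "1 / real (Suc n) \<le> 1 / real (Suc N)"
        using mn by (auto intro!: divide_left_mono)
      then have "\<kappa> / 4 * (LINT x|M. (norm (grad (\<phi> m) x - grad (\<phi> n) x))\<^sup>2) \<le> \<kappa> / 4 * e"
        using gap[of m n] N by simp
      then show ?thesis using \<kappa>_pos by simp
    qed
    then show ?thesis by blast
  qed
  obtain g where g: "g \<in> borel_measurable M" "integrable M (\<lambda>x. (norm (g x))\<^sup>2)"
    "(\<lambda>n. LINT x|M. (norm (grad (\<phi> n) x - g x))\<^sup>2) \<longlonglongrightarrow> 0"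
    by (rule L2_complete[OF test_measurable(2)[OF t] test_integrable_grad_sq[OF t] small])
  have poincare: "(LINT x|M. (norm (\<phi> m x - \<phi> n x))\<^sup>2)
      \<le> vol * (LINT x|M. (norm (grad (\<phi> m) x - grad (\<phi> n) x))\<^sup>2)" for m n
    using moment_bound[OF J_midpoint(3)[OF t[of m] t[of n] D[of m] D[of n] _ lam(2)], of 1] lam
      J_midpoint(4)[OF t[of m] t[of n] D[of m] D[of n] _ lam(2)]
    by (simp add: Dir_def mult.commute)
  have small': "\<exists>N. \<forall>m\<ge>N. \<forall>n\<ge>N. (LINT x|M. (norm (\<phi> m x - \<phi> n x))\<^sup>2) \<le> e" if e: "0 < e" for e
  proof -
    \<comment> \<open>Dividing by \<open>vol + 1\<close> covers an empty domain too, which the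
      locale allows.\<close>
    have v: "0 < vol + 1" by (simp add: add_nonneg_pos)
    obtain N where N: "\<And>m n. m \<ge> N \<Longrightarrow> n \<ge> N \<Longrightarrow>
        (LINT x|M. (norm (grad (\<phi> m) x - grad (\<phi> n) x))\<^sup>2) \<le> e / (vol + 1)"
      using small[of "e / (vol + 1)"] e v by auto
    have "(LINT x|M. (norm (\<phi> m x - \<phi> n x))\<^sup>2) \<le> e" if "m \<ge> N" "n \<ge> N" for m n
    proof -
      have "(LINT x|M. (norm (\<phi> m x - \<phi> n x))\<^sup>2) \<le> vol * (e / (vol + 1))"
        using poincare[of m n] mult_left_mono[OF N[OF that], of vol] by simp
      also have "\<dots> \<le> e" using e v by (simp add: field_simps)
      finally show ?thesis .
    qed
    then show ?thesis by blast
  qed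
  have isq: "integrable M (\<lambda>x. (norm (\<phi> n x))\<^sup>2)" for n using test_integrable_sq[OF t] by simp
  obtain u where u: "u \<in> borel_measurable M" "integrable M (\<lambda>x. (norm (u x))\<^sup>2)"
    "(\<lambda>n. LINT x|M. (norm (\<phi> n x - u x))\<^sup>2) \<longlonglongrightarrow> 0"
    by (rule L2_complete[OF test_measurable(1)[OF t] isq small'])
  have A: "approx \<phi> u g" unfolding approx_def using u g t by simp
  have "(\<lambda>n. J lam (\<phi> n)) \<longlonglongrightarrow> c"
  proof (rule tendsto_sandwich[OF _ _ tendsto_const])
    have "(\<lambda>n. c + 1 / real (Suc n)) \<longlonglongrightarrow> c + 0" by (intro tendsto_intros LIMSEQ_Suc lim_1_over_n)
    then show "(\<lambda>n. c + 1 / real (Suc n)) \<longlonglongrightarrow> c" by simp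
    show "\<forall>\<^sub>F n in sequentially. J lam (\<phi> n) \<le> c + 1 / real (Suc n)" 
      by (intro always_eventually allI less_imp_le \<phi>(2))
    show "\<forall>\<^sub>F n in sequentially. c \<le> J lam (\<phi> n)" using c_le t D by auto
  qed
  then have "energy \<Omega> F lam u g = c" using energy_tendsto[OF A D] LIMSEQ_unique by blast
  then show ?thesis by (rule that[OF A D _ c_le])
qed

text \<open>Both terms are differentiated under the integral. The exponential one is delicate:
  \<open>v\<close> may be unbounded and has only some small exponential moment.\<close>

lemma energy_differentiable:
  assumes A: "approx \<phi> u g" and D: "\<And>n. Dir (\<phi> n) \<le> 1 / 32" and B: "approx \<psi> v h"
  obtains d where "((\<lambda>t. energy \<Omega> F lam (\<lambda>x. u x + t * v x) (\<lambda>x. g x + t *\<^sub>R h x)) has_real_derivative d) (at 0)"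
proof -
  note [measurable] = approxD(1,2)[OF A] approxD(1,2)[OF B]
  have Fm [measurable]: "F \<in> borel_measurable borel"
    by (intro borel_measurable_continuous_onI admissible_F_continuous admissible)
  have "\<forall>x. \<exists>d. ((\<lambda>t. (F (g x + t *\<^sub>R h x))\<^sup>2) has_real_derivative d) (at 0)"
    using admissible_F_square_directional_derivative[OF admissible] by blast
  then obtain k' where k': "\<And>x. ((\<lambda>t. (F (g x + t *\<^sub>R h x))\<^sup>2) has_real_derivative k' x) (at 0)" by metis
  have "((\<lambda>t. LINT x|M. (F (g x + t *\<^sub>R h x))\<^sup>2) has_real_derivative (LINT x|M. k' x)) (at 0)"
  proof (rule has_real_derivative_integral[where \<delta> = 1 and k' = k'
        and w = "\<lambda>x. b\<^sup>2 * (2 * (norm (g x) * norm (h x)) + (norm (h x))\<^sup>2)"])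
    show "integrable M (\<lambda>x. (F (g x + 0 *\<^sub>R h x))\<^sup>2)" using approx_F_integrable[OF A] by simp
    have "integrable M (\<lambda>x. norm (g x) * norm (h x))"
      by (rule integrable_mult_of_squares) (use approxD[OF A] approxD[OF B] in auto)
    then show "integrable M (\<lambda>x. b\<^sup>2 * (2 * (norm (g x) * norm (h x)) + (norm (h x))\<^sup>2))"
      using approxD(4)[OF B] by auto
    fix t :: real and x assume t: "\<bar>t\<bar> < 1"
    have "norm (g x + t *\<^sub>R h x) \<le> norm (g x) + \<bar>t\<bar> * norm (h x)"
      using norm_triangle_ineq[of "g x" "t *\<^sub>R h x"] by simp
    also have "\<dots> \<le> norm (g x) + 1 * norm (h x)" using t by (intro add_left_mono mult_right_mono) auto
    finally have le: "norm (g x + t *\<^sub>R h x) + norm (g x) \<le> 2 * norm (g x) + norm (h x)" by simp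
    have "\<bar>(F (g x + t *\<^sub>R h x))\<^sup>2 - (F (g x))\<^sup>2\<bar>
        \<le> b\<^sup>2 * (norm (t *\<^sub>R h x) * (norm (g x + t *\<^sub>R h x) + norm (g x)))"
      using F_sq_growth[of "g x + t *\<^sub>R h x" "g x"] by simp
    also have "\<dots> \<le> b\<^sup>2 * (norm (t *\<^sub>R h x) * (2 * norm (g x) + norm (h x)))"
      by (intro mult_left_mono le) auto
    finally show "\<bar>(F (g x + t *\<^sub>R h x))\<^sup>2 - (F (g x + 0 *\<^sub>R h x))\<^sup>2\<bar>
        \<le> \<bar>t\<bar> * (b\<^sup>2 * (2 * (norm (g x) * norm (h x)) + (norm (h x))\<^sup>2))"
      by (simp add: algebra_simps power2_eq_square)
  qed (use k' in auto)
  note dF = this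
  obtain s where s: "0 < s" "integrable M (\<lambda>x. exp (s * \<bar>v x\<bar>))" by (rule approx_exp_integrable[OF B])
  note eu = approx_exp_sq[OF A D]
  have "((\<lambda>t. LINT x|M. exp (u x + t * v x)) has_real_derivative (LINT x|M. v x * exp (u x))) (at 0)"
  \<comment> \<open>For \<open>\<bar>t\<bar> < s / 4\<close> put
    \<open>y = s * \<bar>v x\<bar> / 4\<close>. One \<open>exp y\<close> absorbs the factor
    \<open>\<bar>v x\<bar>\<close>, a second one the shift \<open>t * v x\<close>; the remaining
    product \<open>exp \<bar>u x\<bar> * exp (2 * y)\<close> is split by
    \<open>p * q \<le> p\<^sup>2 + q\<^sup>2\<close>, producing the exponents 2 and
    \<open>4 * y = s * \<bar>v x\<bar>\<close>.\<close>
  proof (rule has_real_derivative_integral[where \<delta> = "s / 4"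
        and w = "\<lambda>x. (4 / s) * (2 * (exp (2 * \<bar>u x\<bar>) + exp (s * \<bar>v x\<bar>)))"])
    show "((\<lambda>t. exp (u x + t * v x)) has_real_derivative v x * exp (u x)) (at 0)" for x
      by (auto intro!: derivative_eq_intros)
    show "integrable M (\<lambda>x. (4 / s) * (2 * (exp (2 * \<bar>u x\<bar>) + exp (s * \<bar>v x\<bar>))))"
      using s(2) eu(1) by auto
    show "integrable M (\<lambda>x. exp (u x + 0 * v x))" using eu(3) by simp
    fix t :: real and x assume t: "\<bar>t\<bar> < s / 4"
    define y where "y = s * \<bar>v x\<bar> / 4"
    have y0: "0 \<le> y" using s by (simp add: y_def)
    have tv: "\<bar>t * v x\<bar> \<le> y"
      using mult_right_mono[of "\<bar>t\<bar>" "s / 4" "\<bar>v x\<bar>"] t by (simp add: abs_mult y_def)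
    have v: "\<bar>v x\<bar> \<le> (4 / s) * exp y"
      using exp_ge_add_one_self[of y] s by (simp add: y_def field_simps)
    have e1: "exp (u x + t * v x) + exp (u x + 0) \<le> 2 * (exp \<bar>u x\<bar> * exp y)"
    proof -
      have "exp (u x + t * v x) \<le> exp (\<bar>u x\<bar> + y)" "exp (u x + 0) \<le> exp (\<bar>u x\<bar> + y)"
        using tv y0 by auto
      then show ?thesis by (simp add: exp_add)
    qed
    have e2: "exp y * (exp \<bar>u x\<bar> * exp y) \<le> exp (2 * \<bar>u x\<bar>) + exp (s * \<bar>v x\<bar>)"
    proof -
      define p q where "p = exp \<bar>u x\<bar>" and "q = exp (2 * y)"
      have "p * q \<le> p\<^sup>2 + q\<^sup>2"
      proof -
        have "0 \<le> p * q" by (simp add: p_def q_def)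
        then show ?thesis using sum_squares_bound[of p q] by linarith
      qed
      moreover have "p\<^sup>2 = exp (2 * \<bar>u x\<bar>)" "q\<^sup>2 = exp (s * \<bar>v x\<bar>)" "exp y * (exp \<bar>u x\<bar> * exp y) = p * q"
        by (simp_all add: p_def q_def y_def power2_eq_square exp_add[symmetric])
      ultimately show ?thesis by simp
    qed
    have "\<bar>exp (u x + t * v x) - exp (u x + 0)\<bar> \<le> \<bar>t * v x\<bar> * (exp (u x + t * v x) + exp (u x + 0))"
      using abs_exp_diff_le[of "u x + t * v x" "u x + 0"] by simp
    also have "\<dots> \<le> (\<bar>t\<bar> * ((4 / s) * exp y)) * (2 * (exp \<bar>u x\<bar> * exp y))"
      unfolding abs_mult using s by (intro mult_mono e1 v order_refl) auto
    also have "\<dots> = (\<bar>t\<bar> * (4 / s) * 2) * (exp y * (exp \<bar>u x\<bar> * exp y))" by (simp only: mult_ac)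
    also have "\<dots> \<le> (\<bar>t\<bar> * (4 / s) * 2) * (exp (2 * \<bar>u x\<bar>) + exp (s * \<bar>v x\<bar>))"
      using s by (intro mult_left_mono e2) auto
    finally show "\<bar>exp (u x + t * v x) - exp (u x + 0 * v x)\<bar>
        \<le> \<bar>t\<bar> * ((4 / s) * (2 * (exp (2 * \<bar>u x\<bar>) + exp (s * \<bar>v x\<bar>))))"
      by (simp add: mult_ac)
  qed (use s in auto)
  then show ?thesis
    unfolding energy_eq
    by (intro that[of "(LINT x|M. k' x) / 2 - lam * (LINT x|M. v x * exp (u x))"])
       (auto simp: energy_eq intro!: derivative_eq_intros dF)
qed

text \<open>The Dirichlet integral of \<open>u + t v\<close> is a quadratic polynomial in
  \<open>t\<close>, so a strict bound at 0 persists nearby.\<close>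

lemma gradient_norm_lt_near:
  assumes A: "approx \<phi> u g" and B: "approx \<psi> v h" and lt: "(LINT x|M. (norm (g x))\<^sup>2) < C"
  shows "\<exists>d>0. \<forall>t. \<bar>t\<bar> < d \<longrightarrow> (LINT x|M. (norm (g x + t *\<^sub>R h x))\<^sup>2) < C"
proof -
  note [measurable] = approxD(2)[OF A] approxD(2)[OF B]
  have gh: "integrable M (\<lambda>x. g x \<bullet> h x)"
  proof (rule Bochner_Integration.integrable_bound)
    show "integrable M (\<lambda>x. norm (g x) * norm (h x))"
      by (rule integrable_mult_of_squares) (use approxD[OF A] approxD[OF B] in auto)
  qed (auto simp: Cauchy_Schwarz_ineq2)
  have eq: "(LINT x|M. (norm (g x + t *\<^sub>R h x))\<^sup>2)
      = (LINT x|M. (norm (g x))\<^sup>2) + 2 * t * (LINT x|M. g x \<bullet> h x) + t\<^sup>2 * (LINT x|M. (norm (h x))\<^sup>2)" for t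
  proof -
    have "(norm (g x + t *\<^sub>R h x))\<^sup>2 = (norm (g x))\<^sup>2 + 2 * t * (g x \<bullet> h x) + t\<^sup>2 * (norm (h x))\<^sup>2" for x
      unfolding power2_norm_eq_inner by (simp add: inner_simps inner_commute power2_eq_square algebra_simps)
    then show ?thesis using gh approxD(4)[OF A] approxD(4)[OF B] by simp
  qed
  have "((\<lambda>t. (LINT x|M. (norm (g x))\<^sup>2) + 2 * t * (LINT x|M. g x \<bullet> h x) + t\<^sup>2 * (LINT x|M. (norm (h x))\<^sup>2))
      \<longlongrightarrow> (LINT x|M. (norm (g x))\<^sup>2) + 2 * 0 * (LINT x|M. g x \<bullet> h x) + 0\<^sup>2 * (LINT x|M. (norm (h x))\<^sup>2)) (nhds 0)"
    by (intro tendsto_intros filterlim_ident)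
  then have "\<forall>\<^sub>F t in nhds 0. (LINT x|M. (norm (g x + t *\<^sub>R h x))\<^sup>2) < C"
    unfolding eq using lt by (intro order_tendstoD(2)) auto
  then show ?thesis unfolding eventually_nhds_metric by (simp add: dist_real_def)
qed

lemma exists_critical_point:
  assumes ne: "\<Omega> \<noteq> {}" and lam: "0 < lam" "lam * vol \<le> \<kappa> / 4" "lam * vol \<le> a\<^sup>2 / 256"
  shows "\<exists>u g. critical_point \<Omega> F lam u g \<and> energy \<Omega> F lam u g < - lam * vol"
proof -
  obtain \<phi> u g c where A: "approx \<phi> u g" and D: "\<And>n. Dir (\<phi> n) \<le> 1 / 32" and c: "energy \<Omega> F lam u g = c"
    and c_le: "\<And>\<psi>. test_fun \<Omega> \<psi> \<Longrightarrow> Dir \<psi> \<le> 1 / 32 \<Longrightarrow> c \<le> J lam \<psi>"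
    using minimizing_sequence[OF lam(1,2)] by metis
  note eu = approx_exp_sq[OF A D]
  have c_lt: "c < - lam * vol"
  proof -
    obtain \<beta> e S where \<beta>: "test_fun \<Omega> \<beta>" "\<And>x. 0 \<le> \<beta> x" "0 < e" "S \<in> lmeasurable" "S \<subseteq> \<Omega>"
      "0 < measure lebesgue S" "\<And>x. x \<in> S \<Longrightarrow> e \<le> \<beta> x"
      using exists_bump_test_fun[OF open_domain ne] by metis
    have sm: "smooth2 \<beta>" using \<beta> by (simp add: test_fun_def)
    have \<beta>i: "integrable M \<beta>"
      using square_integrable_imp_integrable[OF test_measurable(1)[OF \<beta>(1)] test_integrable_sq[OF \<beta>(1)]] .
    have Ipos: "0 < (LINT x|M. \<beta> x)"
    proof -
      have Ss: "S \<in> sets M" using \<beta>(4,5) by (auto simp: sets_restrict_space_iff fmeasurable_def)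
      have "0 < e * measure M S" using \<beta> by (simp add: measure_restrict_space)
      also have "\<dots> = (LINT x|M. e * indicator S x)" using Ss \<beta>(5) by (simp add: space_restrict_space Int_absorb2)
      also have "\<dots> \<le> (LINT x|M. \<beta> x)"
        using \<beta>i Ss \<beta>(2,7)
        by (intro integral_mono) (auto split: split_indicator simp: emeasure_finite less_top[symmetric])
      finally show ?thesis .
    qed
    define I where "I = (LINT x|M. \<beta> x)"
    define P where "P = (LINT x|M. (F (grad \<beta> x))\<^sup>2)"
    define q where "q = Dir \<beta>"
    have P0: "0 \<le> P" and q0: "0 \<le> q" by (simp_all add: P_def q_def Dir_def)
    \<comment> \<open>The first bound gives \<open>t\<^sup>2 \<le> t\<close>, the second keeps
      \<open>t * \<beta>\<close> in the ball, the third makes the quadratic cost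
      \<open>t\<^sup>2 * P / 2\<close> smaller than the linear gain \<open>lam * t * I\<close>.
      Adding 1 in the denominators avoids division by 0.\<close>
    define t where "t = min (min 1 (1 / (32 * (q + 1)))) (lam * I / (P + 1))"
    have t: "0 < t" "t \<le> 1" "t * (32 * (q + 1)) \<le> 1" "t * (P + 1) \<le> lam * I"
    proof -
      show "t \<le> 1" by (simp add: t_def)
      show "0 < t" using q0 P0 lam Ipos by (auto simp: t_def I_def intro!: divide_pos_pos mult_pos_pos)
      have "t \<le> 1 / (32 * (q + 1))" "t \<le> lam * I / (P + 1)" by (auto simp: t_def)
      then show "t * (32 * (q + 1)) \<le> 1" "t * (P + 1) \<le> lam * I"
        using q0 P0 by (simp_all add: pos_le_divide_eq)
    qed
    define \<eta> where "\<eta> x = t * \<beta> x" for x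
    have te: "test_fun \<Omega> \<eta>" unfolding \<eta>_def using test_fun_lincomb[OF \<beta>(1) \<beta>(1), of t 0] by simp
    have gr: "grad \<eta> x = t *\<^sub>R grad \<beta> x" for x
      unfolding \<eta>_def using grad_lincomb[OF sm sm, of t 0 x] by simp
    have tt: "t\<^sup>2 \<le> t" using t by (simp add: power2_eq_square mult_left_le)
    have "Dir \<eta> = t\<^sup>2 * q" by (simp add: Dir_def q_def gr power_mult_distrib)
    also have "\<dots> \<le> t * q" by (intro mult_right_mono tt q0)
    also have "\<dots> \<le> 1 / 32" using t by (simp add: algebra_simps)
    finally have "c \<le> J lam \<eta>" by (intro c_le te)
    also have "\<dots> < - lam * vol"
    proof -
      have hom: "F (t *\<^sub>R x) = \<bar>t\<bar> * F x" for x using admissible unfolding admissible_F_def by blast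
      have 1: "(LINT x|M. (F (grad \<eta> x))\<^sup>2) = t\<^sup>2 * P" by (simp add: gr hom P_def power_mult_distrib)
      have "vol + t * I = (LINT x|M. 1 + t * \<beta> x)" using \<beta>i measure_space by (simp add: I_def)
      also have "\<dots> \<le> (LINT x|M. exp (\<eta> x))"
        using \<beta>i test_integrable_exp(2)[OF te, of 1]
        by (intro integral_mono) (auto simp: \<eta>_def exp_ge_add_one_self)
      finally have 2: "lam * (vol + t * I) \<le> lam * (LINT x|M. exp (\<eta> x))"
        using lam by (intro mult_left_mono) auto
      have "t * P < lam * I" using t by (simp add: algebra_simps)
      then have "t * (t * P) < t * (lam * I)" using t by (intro mult_strict_left_mono)
      moreover have "0 \<le> t * (t * P)" using t P0 by simp
      ultimately show ?thesis using 2 unfolding J_def energy_eq 1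
        by (simp add: power2_eq_square algebra_simps)
    qed
    finally show ?thesis .
  qed
  have inner: "(LINT x|M. (norm (g x))\<^sup>2) < 1 / 32"
  proof -
    have "a\<^sup>2 * (LINT x|M. (norm (g x))\<^sup>2) = (LINT x|M. (a * norm (g x))\<^sup>2)" by (simp add: power_mult_distrib)
    also have "\<dots> \<le> (LINT x|M. (F (g x))\<^sup>2)"
      using approxD(4)[OF A] approx_F_integrable[OF A] lower a_pos
      by (intro integral_mono power_mono) (auto simp: power_mult_distrib)
    \<comment> \<open>This is the comparison with the zero function, rearranged. Bounding the
      bracket by \<open>4 * vol\<close> gives \<open>8 * lam * vol\<close>, and
      \<open>256 = 8 * 32\<close> matches the radius of the ball.\<close>
    also have "\<dots> < 2 * lam * ((LINT x|M. exp (u x)) - vol)"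
      using c c_lt unfolding energy_eq by (simp add: algebra_simps)
    also have "\<dots> \<le> 2 * lam * (4 * vol)"
    proof (intro mult_left_mono)
      show "(LINT x|M. exp (u x)) - vol \<le> 4 * vol"
        using eu(6) measure_nonneg[of lebesgue \<Omega>] by linarith
    qed (use lam in auto)
    also have "\<dots> \<le> a\<^sup>2 * (1 / 32)" using lam(3) by (simp add: mult.assoc)
    finally show ?thesis using a_pos by (simp add: field_simps)
  qed
  have crit: "((\<lambda>t. energy \<Omega> F lam (\<lambda>x. u x + t * v x) (\<lambda>x. g x + t *\<^sub>R h x)) has_real_derivative 0) (at 0)"
    if B: "approx \<psi> v h" for \<psi> v h
  proof -
    obtain d where d: "((\<lambda>t. energy \<Omega> F lam (\<lambda>x. u x + t * v x) (\<lambda>x. g x + t *\<^sub>R h x))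
        has_real_derivative d) (at 0)"
      by (rule energy_differentiable[OF A D B])
    obtain r where r: "0 < r" "\<And>t. \<bar>t\<bar> < r \<Longrightarrow> (LINT x|M. (norm (g x + t *\<^sub>R h x))\<^sup>2) < 1 / 32"
      using gradient_norm_lt_near[OF A B inner] by blast
    have "energy \<Omega> F lam (\<lambda>x. u x + 0 * v x) (\<lambda>x. g x + 0 *\<^sub>R h x)
        \<le> energy \<Omega> F lam (\<lambda>x. u x + t * v x) (\<lambda>x. g x + t *\<^sub>R h x)" if t: "\<bar>0 - t\<bar> < r" for t
    proof -
      define \<eta> where "\<eta> n = (\<lambda>x. \<phi> n x + t * \<psi> n x)" for n
      have X: "approx \<eta> (\<lambda>x. u x + t * v x) (\<lambda>x. g x + t *\<^sub>R h x)"
        unfolding \<eta>_def by (rule approx_add_scaled[OF A B])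
      \<comment> \<open>Minimality is known against test functions only. Since the varied function
        has Dirichlet integral strictly below 1/32, its approximants are eventually competitors, and
        the inequality passes to their limit.\<close>
      have "\<forall>\<^sub>F n in sequentially. Dir (\<eta> n) < 1 / 32"
        using order_tendstoD(2)[OF approx_Dir_tendsto[OF X] r(2)] t by simp
      then obtain N where "\<And>n. n \<ge> N \<Longrightarrow> Dir (\<eta> n) < 1 / 32"
        by (auto simp: eventually_sequentially)
      then have N: "Dir (\<eta> (n + N)) \<le> 1 / 32" for n by (simp add: less_imp_le)
      note X' = approx_offset[OF X, of N]
      have "c \<le> energy \<Omega> F lam (\<lambda>x. u x + t * v x) (\<lambda>x. g x + t *\<^sub>R h x)"
        by (rule LIMSEQ_le_const[OF energy_tendsto[OF X' N]]) (use c_le N approxD(5)[OF X] in auto)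
      then show ?thesis using c by simp
    qed
    then have "d = 0" using DERIV_local_min[OF d r(1)] by blast
    with d show ?thesis by simp
  qed
  have "critical_point \<Omega> F lam u g"
    unfolding critical_point_def set_integrable_eq W012_0_iff using A eu(3) crit by blast
  with c c_lt show ?thesis by blast
qed

end

theorem theorem3p3:
  fixes \<Omega> :: "(real^2) set" and F :: "real^2 \<Rightarrow> real"
  assumes "open \<Omega>" "connected \<Omega>" "bounded \<Omega>" "\<Omega> \<noteq> {}"
    and "admissible_F F"
  shows "\<exists>lam0 > 0. \<forall>lam. 0 < lam \<and> lam < lam0 \<longrightarrow>
           (\<exists>u g. critical_point \<Omega> F lam u g \<and>
                  energy \<Omega> F lam u g < - lam * measure lebesgue \<Omega>)"
proof -
  obtain a b where ab: "0 < a" "a \<le> b" "\<And>x. a * norm x \<le> F x" "\<And>x. F x \<le> b * norm x"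
    using admissible_F_bounds[OF assms(5)] by metis
  obtain \<kappa> where \<kappa>: "0 < \<kappa>"
    "\<And>x y. (F ((1/2) *\<^sub>R (x + y)))\<^sup>2 \<le> (F x)\<^sup>2 / 2 + (F y)\<^sup>2 / 2 - \<kappa> * (norm (x - y))\<^sup>2"
    using admissible_F_strongly_convex[OF assms(5)] by metis
  interpret finsler_domain \<Omega> F a b \<kappa>
    using assms ab \<kappa> by unfold_locales auto
  \<comment> \<open>Chosen so that \<open>lam * (vol + 1)\<close>, and with it
    \<open>lam * vol\<close>, stays below both thresholds.\<close>
  define lam0 where "lam0 = min (\<kappa> / 4) (a\<^sup>2 / 256) / (vol + 1)"
  have v: "0 < vol + 1" by (simp add: add_nonneg_pos)
  have pos: "0 < lam0" using \<kappa>(1) ab(1) v by (simp add: lam0_def)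
  have "\<exists>u g. critical_point \<Omega> F lam u g \<and> energy \<Omega> F lam u g < - lam * vol"
    if lam: "0 < lam" "lam < lam0" for lam
  proof (rule exists_critical_point[OF assms(4) lam(1)])
    have "lam * vol \<le> lam * (vol + 1)" using lam by simp
    also have "\<dots> \<le> lam0 * (vol + 1)" using lam v by (intro mult_right_mono) auto
    also have "\<dots> = min (\<kappa> / 4) (a\<^sup>2 / 256)" using v by (simp add: lam0_def)
    finally show "lam * vol \<le> \<kappa> / 4" "lam * vol \<le> a\<^sup>2 / 256" by auto
  qed
  with pos show ?thesis by blast
qed

end
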